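(* For every nonnegative integer $m$, the space $\mathcal{GB}^2_m(\mathbb H)$ is a right quaternionic Hilbert space. The quaternionic Hermite polynomials $H_{n,m}$, for varying $n=0,1,2,\dots$ and fixed $m$, belong to $\mathcal{GB}^2_m(\mathbb H)$ and constitute an orthogonal basis of it.
   Context: $\mathbb H$ is the division algebra of real quaternions and $\mathbb S=\{q\in\mathbb H:q^2=-1\}$. The quaternionic Hermite polynomials are $$H_{m,n}(q,\overline q)=m!\,n!\sum_{j=0}^{\min(m,n)}\frac{(-1)^j}{j!}\frac{q^{m-j}\overline q^{\,n-j}}{(m-j)!(n-j)!}.$$ The generalized quaternionic Bargmann space of level $m$ is $$\mathcal{GB}^2_m(\mathbb H)=\Big\{f(q)=\sum_{n=0}^{+\infty}H_{n,m}(q,\overline q)C_n:\ C_n\in\mathbb H,\ \pi m!\sum_{n=0}^{+\infty}n!\,|C_n|^2<+\infty\Big\},$$ equipped with the inner product $\langle f,g\rangle=\int_{\mathbb H}\overline{f(q)}g(q)e^{-|q|^2}d\lambda(q)$, where integration is performed according to $$\int_{\mathbb H}F(q)e^{-|q|^2}d\lambda(q)=\int_{\mathbb S}\int_0^{2\pi}\int_0^\infty F(re^{I\theta})e^{-r^2}\,r\,dr\,d\theta\,d\sigma(I),$$ $d\sigma$ being the area measure on $\mathbb S$ normalized to total mass one, so that $\|H_{m,n}\|^2=\pi m!\,n!$ and $\|f\|^2=\pi m!\sum_n n!|C_n|^2$ for $f=\sum_nH_{n,m}C_n\in\mathcal{GB}_m^2(\mathbb H)$. *)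

theory Defs
  imports "HOL-Analysis.Analysis" "HOL-Library.Function_Algebras"
begin

section \<open>The division algebra of real quaternions\<close>

datatype quat = Quat (qRe: real) (qI: real) (qJ: real) (qK: real)

lemma quat_eq_iff: "x = y \<longleftrightarrow> qRe x = qRe y \<and> qI x = qI y \<and> qJ x = qJ y \<and> qK x = qK y"
  by (cases x; cases y) simp

instantiation quat :: ab_group_add
begin

definition "0 = Quat 0 0 0 0"
definition "x + y = Quat (qRe x + qRe y) (qI x + qI y) (qJ x + qJ y) (qK x + qK y)"
definition "- x = Quat (- qRe x) (- qI x) (- qJ x) (- qK x)"
definition "x - y = Quat (qRe x - qRe y) (qI x - qI y) (qJ x - qJ y) (qK x - qK y)"

instance
  by standard (simp_all add: zero_quat_def plus_quat_def uminus_quat_def minus_quat_def)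

end

lemma quat_add_sel [simp]:
  "qRe (0::quat) = 0" "qI (0::quat) = 0" "qJ (0::quat) = 0" "qK (0::quat) = 0"
  "qRe (x + y) = qRe x + qRe y" "qI (x + y) = qI x + qI y"
  "qJ (x + y) = qJ x + qJ y" "qK (x + y) = qK x + qK y"
  "qRe (- x) = - qRe x" "qI (- x) = - qI x" "qJ (- x) = - qJ x" "qK (- x) = - qK x"
  "qRe (x - y) = qRe x - qRe y" "qI (x - y) = qI x - qI y"
  "qJ (x - y) = qJ x - qJ y" "qK (x - y) = qK x - qK y"
  by (simp_all add: zero_quat_def plus_quat_def uminus_quat_def minus_quat_def)

instantiation quat :: real_algebra_1
begin

definition "1 = Quat 1 0 0 0"
definition "x * y = Quat
  (qRe x * qRe y - qI x * qI y - qJ x * qJ y - qK x * qK y)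
  (qRe x * qI y + qI x * qRe y + qJ x * qK y - qK x * qJ y)
  (qRe x * qJ y - qI x * qK y + qJ x * qRe y + qK x * qI y)
  (qRe x * qK y + qI x * qJ y - qJ x * qI y + qK x * qRe y)"
definition "r *\<^sub>R x = Quat (r * qRe x) (r * qI x) (r * qJ x) (r * qK x)"

instance
  by standard
    (simp_all add: one_quat_def times_quat_def scaleR_quat_def quat_eq_iff algebra_simps)

end

lemma quat_mult_sel [simp]:
  "qRe (1::quat) = 1" "qI (1::quat) = 0" "qJ (1::quat) = 0" "qK (1::quat) = 0"
  "qRe (x * y) = qRe x * qRe y - qI x * qI y - qJ x * qJ y - qK x * qK y"
  "qI (x * y) = qRe x * qI y + qI x * qRe y + qJ x * qK y - qK x * qJ y"
  "qJ (x * y) = qRe x * qJ y - qI x * qK y + qJ x * qRe y + qK x * qI y"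
  "qK (x * y) = qRe x * qK y + qI x * qJ y - qJ x * qI y + qK x * qRe y"
  "qRe (r *\<^sub>R x) = r * qRe x" "qI (r *\<^sub>R x) = r * qI x"
  "qJ (r *\<^sub>R x) = r * qJ x" "qK (r *\<^sub>R x) = r * qK x"
  by (simp_all add: one_quat_def times_quat_def scaleR_quat_def)

definition qcnj :: "quat \<Rightarrow> quat"
  where "qcnj x = Quat (qRe x) (- qI x) (- qJ x) (- qK x)"

lemma qcnj_sel [simp]:
  "qRe (qcnj x) = qRe x" "qI (qcnj x) = - qI x" "qJ (qcnj x) = - qJ x" "qK (qcnj x) = - qK x"
  by (simp_all add: qcnj_def)

instantiation quat :: real_inner
begin

definition inner_quat_def:
  "inner x y = qRe x * qRe y + qI x * qI y + qJ x * qJ y + qK x * qK y"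
definition norm_quat_def:
  "norm x = sqrt ((qRe x)\<^sup>2 + (qI x)\<^sup>2 + (qJ x)\<^sup>2 + (qK x)\<^sup>2)"
definition sgn_quat_def: "sgn (x::quat) = x /\<^sub>R norm x"
definition dist_quat_def: "dist (x::quat) y = norm (x - y)"
definition uniformity_quat_def [code del]:
  "(uniformity :: (quat \<times> quat) filter) = (INF e\<in>{0<..}. principal {(x, y). dist x y < e})"
definition open_quat_def [code del]:
  "open (U :: quat set) \<longleftrightarrow> (\<forall>x\<in>U. eventually (\<lambda>(x', y). x' = x \<longrightarrow> y \<in> U) uniformity)"

instance
proof
  fix x y z :: quat and r :: real
  show "(inner x x = 0) = (x = 0)"
    by (simp add: inner_quat_def quat_eq_iff add_nonneg_eq_0_iff)
qed (simp_all add: inner_quat_def norm_quat_def sgn_quat_def dist_quat_def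
      uniformity_quat_def open_quat_def algebra_simps power2_eq_square)

end

lemma norm_quat_mult: "norm (x * y) = norm x * norm (y::quat)"
  unfolding norm_quat_def real_sqrt_mult [symmetric]
  by (simp add: power2_eq_square algebra_simps)

instantiation quat :: real_normed_div_algebra
begin

definition "inverse x = qcnj x /\<^sub>R (norm x)\<^sup>2"
definition "x div y = x * inverse (y::quat)"

instance
proof
  fix x y :: quat
  have *: "x * qcnj x = (norm x)\<^sup>2 *\<^sub>R 1" "qcnj x * x = (norm x)\<^sup>2 *\<^sub>R 1"
    by (simp_all add: quat_eq_iff norm_quat_def power2_eq_square algebra_simps)
  show "x \<noteq> 0 \<Longrightarrow> inverse x * x = 1" "x \<noteq> 0 \<Longrightarrow> x * inverse x = 1"
    by (simp_all add: inverse_quat_def *)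
  show "x div y = x * inverse y"
    by (simp add: divide_quat_def)
  show "inverse (0::quat) = 0"
    by (simp add: inverse_quat_def quat_eq_iff)
  show "norm (x * y) = norm x * norm y"
    by (rule norm_quat_mult)
qed

end

instantiation quat :: euclidean_space
begin

definition Basis_quat_def: "Basis = {Quat 1 0 0 0, Quat 0 1 0 0, Quat 0 0 1 0, Quat 0 0 0 1}"

instance
proof
  fix u v x :: quat
  show "u \<in> Basis \<Longrightarrow> v \<in> Basis \<Longrightarrow> inner u v = (if u = v then 1 else 0)"
    unfolding Basis_quat_def by (elim insertE emptyE; simp add: inner_quat_def)
  show "(\<forall>u\<in>Basis. inner x u = 0) \<longleftrightarrow> x = 0"
    by (simp add: Basis_quat_def inner_quat_def) (simp add: quat_eq_iff)
qed (simp_all add: Basis_quat_def)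

end


section \<open>Right quaternionic Hilbert spaces\<close>

text \<open>
  The carrier is a subset of an additive group; \<open>smul x a\<close> is the right multiple \<open>x a\<close>.
\<close>

locale right_quat_vector_space =
  fixes V :: "'a::ab_group_add set" and smul :: "'a \<Rightarrow> quat \<Rightarrow> 'a"
  assumes zero_closed: "0 \<in> V"
    and add_closed: "x \<in> V \<Longrightarrow> y \<in> V \<Longrightarrow> x + y \<in> V"
    and smul_closed: "x \<in> V \<Longrightarrow> smul x a \<in> V"
    and smul_add_left: "x \<in> V \<Longrightarrow> y \<in> V \<Longrightarrow> smul (x + y) a = smul x a + smul y a"
    and smul_add_right: "x \<in> V \<Longrightarrow> smul x (a + b) = smul x a + smul x b"
    and smul_mult: "x \<in> V \<Longrightarrow> smul x (a * b) = smul (smul x a) b"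
    and smul_one: "x \<in> V \<Longrightarrow> smul x 1 = x"

locale right_quat_inner_product_space = right_quat_vector_space V smul
  for V :: "'a::ab_group_add set" and smul :: "'a \<Rightarrow> quat \<Rightarrow> 'a" +
  fixes ip :: "'a \<Rightarrow> 'a \<Rightarrow> quat"
  assumes ip_cnj: "x \<in> V \<Longrightarrow> y \<in> V \<Longrightarrow> ip x y = qcnj (ip y x)"
    and ip_add_right: "x \<in> V \<Longrightarrow> y \<in> V \<Longrightarrow> z \<in> V \<Longrightarrow> ip x (y + z) = ip x y + ip x z"
    and ip_smul_right: "x \<in> V \<Longrightarrow> y \<in> V \<Longrightarrow> ip x (smul y a) = ip x y * a"
    \<comment> \<open>by \<open>ip_cnj\<close>, \<open>ip x x\<close> is real\<close>
    and ip_nonneg: "x \<in> V \<Longrightarrow> 0 \<le> qRe (ip x x)"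
    and ip_definite: "x \<in> V \<Longrightarrow> ip x x = 0 \<Longrightarrow> x = 0"

definition ip_norm :: "('a \<Rightarrow> 'a \<Rightarrow> quat) \<Rightarrow> 'a \<Rightarrow> real"
  where "ip_norm ip x = sqrt (qRe (ip x x))"

locale right_quat_hilbert_space = right_quat_inner_product_space V smul ip
  for V :: "'a::ab_group_add set" and smul :: "'a \<Rightarrow> quat \<Rightarrow> 'a" and ip :: "'a \<Rightarrow> 'a \<Rightarrow> quat" +
  assumes complete:
    "(\<And>n. X n \<in> V) \<Longrightarrow>
     (\<forall>e>0. \<exists>N. \<forall>i\<ge>N. \<forall>j\<ge>N. ip_norm ip (X i - X j) < e) \<Longrightarrow>
     \<exists>x\<in>V. (\<lambda>n. ip_norm ip (X n - x)) \<longlonglongrightarrow> 0"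

text \<open>An orthogonal basis: nonzero, pairwise orthogonal vectors whose right linear span is dense.\<close>

definition orthogonal_basis ::
    "'a::ab_group_add set \<Rightarrow> ('a \<Rightarrow> quat \<Rightarrow> 'a) \<Rightarrow> ('a \<Rightarrow> 'a \<Rightarrow> quat) \<Rightarrow> ('i \<Rightarrow> 'a) \<Rightarrow> bool"
  where "orthogonal_basis V smul ip b \<longleftrightarrow>
    (\<forall>i. b i \<in> V \<and> b i \<noteq> 0) \<and>
    (\<forall>i j. i \<noteq> j \<longrightarrow> ip (b i) (b j) = 0) \<and>
    (\<forall>x\<in>V. \<forall>e>0. \<exists>F c. finite F \<and> ip_norm ip (x - (\<Sum>i\<in>F. smul (b i) (c i))) < e)"


section \<open>Gaussian integration over the quaternions\<close>

definition imag_units :: "quat set"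
  where "imag_units = {q. q\<^sup>2 = -1}"

definition sphere_param :: "real \<times> real \<Rightarrow> quat"
  where "sphere_param = (\<lambda>(\<phi>, \<psi>). Quat 0 (sin \<phi> * cos \<psi>) (sin \<phi> * sin \<psi>) (cos \<phi>))"

text \<open>
  The area measure on the unit sphere of the imaginary quaternions, with total mass one:
  in spherical coordinates the area element is \<open>sin \<phi> d\<phi> d\<psi>\<close> on \<open>[0, \<pi>] \<times> [0, 2\<pi>]\<close>, and the
  total area is \<open>4\<pi>\<close>.
\<close>

definition sphere_measure :: "quat measure"
  where "sphere_measure =
    distr (density (restrict_space lborel ({0..pi} \<times> {0..2*pi}))
             (\<lambda>(\<phi>, \<psi>). ennreal (sin \<phi> / (4 * pi))))
      (restrict_space borel imag_units) sphere_param"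

text \<open>
  The integral of \<open>F(q) exp(-|q|\<^sup>2)\<close>, in the coordinates \<open>q = r exp(\<theta> I)\<close>, and its absolute
  convergence.
\<close>

definition gauss_integral :: "(quat \<Rightarrow> quat) \<Rightarrow> quat"
  where "gauss_integral F =
    (LINT I|sphere_measure. (LBINT \<theta>:{0..2*pi}. (LBINT r:{0..}.
       (exp (- r\<^sup>2) * r) *\<^sub>R F (r *\<^sub>R exp (\<theta> *\<^sub>R I)))))"

definition gauss_integrable :: "(quat \<Rightarrow> quat) \<Rightarrow> bool"
  where "gauss_integrable F \<longleftrightarrow>
    set_integrable (sphere_measure \<Otimes>\<^sub>M lborel \<Otimes>\<^sub>M lborel) (imag_units \<times> {0..2*pi} \<times> {0..})
      (\<lambda>(I, \<theta>, r). (exp (- r\<^sup>2) * r) *\<^sub>R F (r *\<^sub>R exp (\<theta> *\<^sub>R I)))"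

lemma sphere_param_in_imag_units: "sphere_param p \<in> imag_units"
proof -
  obtain \<phi> \<psi> where p: "p = (\<phi>, \<psi>)" by (cases p)
  have "(sin \<phi> * cos \<psi>)\<^sup>2 + (sin \<phi> * sin \<psi>)\<^sup>2 + (cos \<phi>)\<^sup>2
      = (sin \<phi>)\<^sup>2 * ((cos \<psi>)\<^sup>2 + (sin \<psi>)\<^sup>2) + (cos \<phi>)\<^sup>2"
    by (simp only: power_mult_distrib distrib_left)
  also have "\<dots> = 1"
    by (metis mult_1_right sin_cos_squared_add sin_cos_squared_add2)
  finally have "(sin \<phi> * cos \<psi>)\<^sup>2 + (sin \<phi> * sin \<psi>)\<^sup>2 + (cos \<phi>)\<^sup>2 = 1" .
  then show ?thesis
    by (simp add: p imag_units_def sphere_param_def quat_eq_iff power2_eq_square)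
qed

lemma sphere_param_measurable:
  "sphere_param \<in>
     measurable (density (restrict_space lborel ({0..pi} \<times> {0..2*pi})) f)
       (restrict_space borel imag_units)"
proof -
  have eq: "sphere_param = (\<lambda>p.
      (sin (fst p) * cos (snd p)) *\<^sub>R Quat 0 1 0 0 + (sin (fst p) * sin (snd p)) *\<^sub>R Quat 0 0 1 0
      + cos (fst p) *\<^sub>R Quat 0 0 0 1)"
    by (auto simp: sphere_param_def quat_eq_iff)
  have "continuous_on UNIV sphere_param"
    unfolding eq by (intro continuous_intros)
  then have "sphere_param \<in> borel_measurable borel"
    by (rule borel_measurable_continuous_onI)
  then have "sphere_param \<in> borel_measurable (restrict_space lborel ({0..pi} \<times> {0..2*pi}))"
    by (intro measurable_restrict_space1) simp
  then show ?thesis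
    by (simp add: measurable_restrict_space2_iff sphere_param_in_imag_units)
qed

lemma emeasure_sphere_measure: "emeasure sphere_measure imag_units = 1"
proof -
  let ?R = "{0..pi} \<times> {0..2*pi} :: (real \<times> real) set"
  let ?d = "\<lambda>(\<phi>::real, \<psi>::real). ennreal (sin \<phi> / (4 * pi))"
  let ?L = "restrict_space lborel ?R"
  have cont: "(\<lambda>p. sin (fst p) / (4 * pi)) \<in> borel_measurable (borel :: (real \<times> real) measure)"
    by (intro borel_measurable_continuous_onI continuous_intros) simp
  have d0: "?d = (\<lambda>p. ennreal (sin (fst p) / (4 * pi)))"
    by auto
  have d: "?d \<in> borel_measurable lborel"
    unfolding d0 using cont by simp
  have dL: "?d \<in> borel_measurable ?L"
    by (intro measurable_restrict_space1 d)
  have R: "?R \<inter> space lborel \<in> sets lborel"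
    by (simp add: borel_closed closed_Times)
  have m: "(\<lambda>p. ?d p * indicator ?R p) \<in> borel_measurable (lborel \<Otimes>\<^sub>M lborel)"
    unfolding lborel_prod using R by (intro borel_measurable_times_ennreal d) simp
  have S: "imag_units \<in> sets (restrict_space borel imag_units)"
    using sets.top[of "restrict_space borel imag_units"] by (simp add: space_restrict_space)
  have vim: "sphere_param -` imag_units \<inter> space (density ?L ?d) = space ?L"
    using sphere_param_in_imag_units by auto
  have fin: "(\<integral>\<^sup>+\<phi>. ennreal (sin \<phi> / (4 * pi)) * indicator {0..pi} \<phi> \<partial>lborel) = ennreal (1 / (2 * pi))"
  proof -
    have "(\<integral>\<^sup>+\<phi>. ennreal (sin \<phi> / (4 * pi)) * indicator {0..pi} \<phi> \<partial>lborel)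
        = ennreal (- cos pi / (4 * pi) - - cos 0 / (4 * pi))"
    proof (rule nn_integral_FTC_Icc)
      show "(\<lambda>\<phi>. sin \<phi> / (4 * pi)) \<in> borel_measurable borel"
        by (intro borel_measurable_continuous_onI continuous_intros) simp
      fix x :: real assume "x \<in> {0..pi}"
      show "((\<lambda>x. - cos x / (4 * pi)) has_real_derivative sin x / (4 * pi)) (at x)"
        by (auto intro!: derivative_eq_intros)
      show "0 \<le> sin x / (4 * pi)"
        using \<open>x \<in> {0..pi}\<close> by (simp add: sin_ge_zero)
    qed simp
    then show ?thesis by simp
  qed
  have "emeasure sphere_measure imag_units = emeasure (density ?L ?d) (space ?L)"
    unfolding sphere_measure_def
    by (subst emeasure_distr[OF sphere_param_measurable S]) (simp only: vim)
  also have "\<dots> = (\<integral>\<^sup>+p. ?d p \<partial>?L)"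
    by (subst emeasure_density) (auto simp: dL intro!: nn_integral_cong)
  also have "\<dots> = (\<integral>\<^sup>+p. ?d p * indicator ?R p \<partial>lborel)"
    by (rule nn_integral_restrict_space[OF R])
  also have "\<dots> = (\<integral>\<^sup>+p. ?d p * indicator ?R p \<partial>(lborel \<Otimes>\<^sub>M lborel))"
    by (simp only: lborel_prod)
  also have "\<dots> = (\<integral>\<^sup>+\<phi>. \<integral>\<^sup>+\<psi>. ennreal (sin \<phi> / (4 * pi)) * indicator {0..pi} \<phi> *
      indicator {0..2*pi} \<psi> \<partial>lborel \<partial>lborel)"
    by (subst lborel.nn_integral_fst [OF m, symmetric])
      (intro nn_integral_cong, simp add: indicator_times mult.assoc)
  also have "\<dots> = (\<integral>\<^sup>+\<phi>. ennreal (sin \<phi> / (4 * pi)) * indicator {0..pi} \<phi> * ennreal (2 * pi) \<partial>lborel)"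
    by (intro nn_integral_cong, subst nn_integral_cmult) simp_all
  also have "\<dots> = ennreal (1 / (2 * pi)) * ennreal (2 * pi)"
    by (subst nn_integral_multc) (simp_all add: fin)
  also have "\<dots> = 1"
    by (simp add: ennreal_mult [symmetric])
  finally show ?thesis .
qed


section \<open>Quaternionic Hermite polynomials and the generalized Bargmann spaces\<close>

text \<open>The powers of \<open>q\<close> and \<open>qcnj q\<close> commute, so their order is immaterial.\<close>

definition quat_hermite :: "nat \<Rightarrow> nat \<Rightarrow> quat \<Rightarrow> quat"
  where "quat_hermite m n q =
    (fact m * fact n) *\<^sub>R
      (\<Sum>j = 0..min m n. ((-1) ^ j / fact j) *\<^sub>R
         ((q ^ (m - j) * qcnj q ^ (n - j)) /\<^sub>R (fact (m - j) * fact (n - j))))"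

definition gen_bargmann :: "nat \<Rightarrow> (quat \<Rightarrow> quat) set"
  where "gen_bargmann m =
    {f. \<exists>C. summable (\<lambda>n. pi * fact m * (fact n * (norm (C n))\<^sup>2)) \<and>
            (\<forall>q. (\<lambda>n. quat_hermite n m q * C n) sums f q)}"

definition right_mult :: "(quat \<Rightarrow> quat) \<Rightarrow> quat \<Rightarrow> (quat \<Rightarrow> quat)"
  where "right_mult f a = (\<lambda>q. f q * a)"

definition bargmann_inner :: "(quat \<Rightarrow> quat) \<Rightarrow> (quat \<Rightarrow> quat) \<Rightarrow> quat"
  where "bargmann_inner f g = gauss_integral (\<lambda>q. qcnj (f q) * g q)"

end

theory Submission
  imports Defs "HOL-Probability.Distributions"
begin

text \<open>
  Everything reduces to a sequence space. On the slice through the imaginary unit \<open>I\<close> the point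
  \<open>q = r exp (\<theta> I)\<close> behaves like a complex number, so, with \<open>q\<^sup>*\<close> for the conjugate,
  \<open>q\<^sup>a q\<^sup>*\<^sup>b = r\<^sup>a\<^sup>+\<^sup>b exp ((a - b) \<theta> I)\<close>. Integration over \<open>\<theta>\<close> annihilates this unless \<open>a = b\<close>, and
  then a Gamma integral over \<open>r\<close> remains (\<open>integral_gauss_monomial\<close>). Pairing \<open>H\<^sub>n\<^sub>,\<^sub>m\<close> with \<open>H\<^sub>k\<^sub>,\<^sub>m\<close>
  thus leaves only the case \<open>n = k\<close>, where the inner sum of coefficients is, for \<open>m \<le> n\<close>, an \<open>m\<close>-th
  finite difference of a polynomial of degree at most \<open>m\<close>; the case \<open>n \<le> m\<close> is symmetric, and the
  double sum collapses to \<open>m! n!\<close> (\<open>hermite_coeff_norm_sum\<close>, \<open>integral_hermite_inner\<close>).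

  For infinite series the nested integral is rewritten as an integral against one measure on the
  quaternions, the image of the weighted product measure under polar coordinates
  (\<open>gauss_integral_eq\<close>). Orthogonality gives the norms of finite sections of a series, Fatou's lemma
  bounds the norm of the remainder by the tail of the coefficient series, and the Cauchy-Schwarz
  inequality carries the inner product to the limit. The result is Parseval's identity
  \<open>\<langle>f, g\<rangle> = (\<Sum>n. \<pi> m! n! C\<^sub>n\<^sup>* D\<^sub>n)\<close> (\<open>bargmann_inner_sums\<close>), together with absolute convergence of the
  integral.

  Because \<open>|H\<^sub>n\<^sub>,\<^sub>m(q)|\<^sup>2 / n!\<close> is summable in \<open>n\<close> for each \<open>q\<close>, every sequence with
  \<open>\<Sum>n. n! |C\<^sub>n|\<^sup>2 < \<infinity>\<close> is the coefficient sequence of a function in the space. Parseval's identity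
  therefore identifies the space with a weighted \<open>\<ell>\<^sup>2\<close> of quaternions. Definiteness and completeness
  are inherited from there (\<open>weighted_l2_complete\<close>), and density of the span says that tails of
  convergent series vanish.
\<close>

section \<open>Conjugation\<close>

lemma norm_qcnj [simp]: "norm (qcnj x) = norm x"
  by (simp add: norm_quat_def)

lemma qcnj_algebra [simp]:
  "qcnj 0 = 0" "qcnj 1 = 1" "qcnj (qcnj x) = x" "qcnj (x + y) = qcnj x + qcnj y"
  "qcnj (x - y) = qcnj x - qcnj y" "qcnj (r *\<^sub>R x) = r *\<^sub>R qcnj x" "qcnj (x * y) = qcnj y * qcnj x"
  by (simp_all add: quat_eq_iff)

lemma bounded_linear_qcnj: "bounded_linear qcnj"
  by (rule bounded_linear_intro[where K = 1]) simp_all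

lemmas continuous_on_qcnj [continuous_intros] = bounded_linear.continuous_on[OF bounded_linear_qcnj]

lemma qcnj_power [simp]: "qcnj (x ^ n) = qcnj x ^ n"
  by (induction n) (simp_all add: power_commutes)

lemma qcnj_sum: "qcnj (sum f A) = (\<Sum>i\<in>A. qcnj (f i))"
  by (rule linear_sum) (rule bounded_linear.linear[OF bounded_linear_qcnj])

lemma qcnj_mult_commute: "qcnj x * x = x * qcnj x"
  by (simp add: quat_eq_iff algebra_simps)

lemma qcnj_mult_self: "qcnj x * x = (norm x)\<^sup>2 *\<^sub>R 1"
  by (simp add: quat_eq_iff norm_quat_def power2_eq_square algebra_simps)

lemma borel_measurable_qcnj [measurable]: "qcnj \<in> borel_measurable borel"
  by (intro borel_measurable_continuous_onI continuous_intros)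

section \<open>Polar form on a complex slice\<close>

lemma imag_unit_mult_self: "I \<in> imag_units \<Longrightarrow> I * I = - 1"
  by (simp add: imag_units_def power2_eq_square)

text \<open>
  A nonzero real part would force the imaginary part of \<open>I\<close> to vanish, because \<open>I\<^sup>2\<close> is real; but then
  \<open>I\<^sup>2\<close> could not be negative.
\<close>

lemma imag_unit_qRe:
  assumes "I \<in> imag_units" shows "qRe I = 0"
proof (rule ccontr)
  assume *: "qRe I \<noteq> 0"
  from imag_unit_mult_self[OF assms] have "I * I = -1" .
  then have "qRe I * qRe I - qI I * qI I - qJ I * qJ I - qK I * qK I = -1"
    "qI I = 0" "qJ I = 0" "qK I = 0"
    using * by (auto simp: quat_eq_iff)
  then have "qRe I * qRe I = -1" by simp
  then show False using zero_le_square[of "qRe I"] by linarith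
qed

text \<open>
  The exponential of a noncommutative algebra is only given by its power series; since \<open>I\<^sup>2 = -1\<close>, the
  terms of that series are those of the cosine and sine series, times \<open>1\<close> and \<open>I\<close>.
\<close>

lemma exp_imag_unit:
  assumes "I \<in> imag_units"
  shows "exp (\<theta> *\<^sub>R I) = cos \<theta> *\<^sub>R 1 + sin \<theta> *\<^sub>R I"
proof -
  \<comment> \<open>multiplication by \<open>I\<close> realises the mutual recursion of the two coefficient sequences\<close>
  have coeff: "I ^ n /\<^sub>R fact n = cos_coeff n *\<^sub>R 1 + sin_coeff n *\<^sub>R I" for n
  proof (induction n)
    case 0
    show ?case by simp
  next
    case (Suc n)
    have "I ^ Suc n /\<^sub>R fact (Suc n) = (I * (I ^ n /\<^sub>R fact n)) /\<^sub>R real (Suc n)"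
      by simp
    also have "\<dots> = cos_coeff (Suc n) *\<^sub>R 1 + sin_coeff (Suc n) *\<^sub>R I"
      unfolding Suc sin_coeff_Suc cos_coeff_Suc
      by (simp add: distrib_left imag_unit_mult_self[OF assms] scaleR_add_right scaleR_diff_right divide_inverse_commute)
    finally show ?case .
  qed
  have "(\<lambda>n. (\<theta> *\<^sub>R I) ^ n /\<^sub>R fact n) sums (cos \<theta> *\<^sub>R 1 + sin \<theta> *\<^sub>R I)"
  proof -
    have "(\<theta> *\<^sub>R I) ^ n /\<^sub>R fact n
        = (cos_coeff n *\<^sub>R \<theta> ^ n) *\<^sub>R 1 + (sin_coeff n *\<^sub>R \<theta> ^ n) *\<^sub>R I" for n
    proof -
      have "(\<theta> *\<^sub>R I) ^ n /\<^sub>R fact n = \<theta> ^ n *\<^sub>R (I ^ n /\<^sub>R fact n)"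
        by (simp add: scaleR_power mult.commute)
      then show ?thesis
        by (simp add: coeff scaleR_add_right mult.commute)
    qed
    then show ?thesis
      by (simp only:) (intro sums_add sums_scaleR_left cos_converges sin_converges)
  qed
  with exp_converges show ?thesis
    by (rule sums_unique2)
qed

lemma imag_unit_cis_mult:
  assumes "I \<in> imag_units"
  shows "(cos a *\<^sub>R 1 + sin a *\<^sub>R I) * (cos b *\<^sub>R 1 + sin b *\<^sub>R I) = cos (a + b) *\<^sub>R 1 + sin (a + b) *\<^sub>R I"
  by (simp add: algebra_simps imag_unit_mult_self[OF assms] cos_add sin_add)

lemma imag_unit_cis_power:
  assumes "I \<in> imag_units"
  shows "(cos a *\<^sub>R 1 + sin a *\<^sub>R I) ^ n = cos (real n * a) *\<^sub>R 1 + sin (real n * a) *\<^sub>R I"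
proof (induction n)
  case (Suc n)
  then show ?case
    using imag_unit_cis_mult[OF assms, of a "real n * a"] by (simp add: distrib_right)
qed simp

section \<open>The Gaussian measure\<close>

text \<open>
  Polar coordinates \<open>(I, \<theta>, r)\<close> with the exponential replaced by its trigonometric form. Off the
  imaginary units the two differ, but this one is visibly continuous, hence measurable, on the whole
  product.
\<close>

definition slice_point :: "quat \<times> real \<times> real \<Rightarrow> quat"
  where "slice_point = (\<lambda>(I, \<theta>, r). r *\<^sub>R (cos \<theta> *\<^sub>R 1 + sin \<theta> *\<^sub>R I))"

definition slice_weight :: "quat \<times> real \<times> real \<Rightarrow> real"
  where "slice_weight = (\<lambda>(I, \<theta>, r). indicator {0..2*pi} \<theta> * (indicator {0..} r * (exp (- r\<^sup>2) * r)))"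

abbreviation slice_space :: "(quat \<times> real \<times> real) measure"
  where "slice_space \<equiv> sphere_measure \<Otimes>\<^sub>M lborel \<Otimes>\<^sub>M lborel"

text \<open>
  The image of the Gaussian weight under polar coordinates. It turns a nested integral over
  \<open>(I, \<theta>, r)\<close> into an ordinary Lebesgue integral, to which Fatou's lemma and the Cauchy-Schwarz
  inequality apply directly.
\<close>

definition gauss_measure :: "quat measure"
  where "gauss_measure = distr (density slice_space slice_weight) borel slice_point"

lemma sets_gauss_measure [simp, measurable_cong]: "sets gauss_measure = sets borel"
  and space_gauss_measure [simp]: "space gauss_measure = UNIV"
  by (simp_all add: gauss_measure_def)

lemma space_sphere_measure [simp]: "space sphere_measure = imag_units"
  by (simp add: sphere_measure_def space_restrict_space)

lemma prob_space_sphere_measure: "prob_space sphere_measure"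
  by (rule prob_spaceI) (simp add: emeasure_sphere_measure)

text \<open>
  The sphere measure lives on the trace of the Borel sets on the imaginary units, so the inclusion into
  the quaternions has to be made measurable.
\<close>

lemma measurable_sphere_measure_borel [measurable]:
  "(\<lambda>I. I) \<in> borel_measurable sphere_measure"
proof -
  have "sets sphere_measure = sets (restrict_space borel imag_units)"
    by (simp add: sphere_measure_def)
  then have "borel_measurable sphere_measure = (borel_measurable (restrict_space borel imag_units) :: (quat \<Rightarrow> quat) set)"
    by (intro measurable_cong_sets) auto
  then show ?thesis
    by (simp add: measurable_restrict_space1)
qed

lemma measurable_slice_point [measurable]: "slice_point \<in> borel_measurable slice_space"
proof -
  have "(\<lambda>p. fst p) \<in> borel_measurable slice_space"
    using measurable_compose[OF measurable_fst measurable_sphere_measure_borel] by simp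
  then have [measurable]: "fst \<in> borel_measurable slice_space" by simp
  show ?thesis
    unfolding slice_point_def case_prod_beta by measurable
qed

lemma measurable_slice_weight [measurable]: "slice_weight \<in> borel_measurable slice_space"
  unfolding slice_weight_def case_prod_beta by measurable

lemma slice_weight_nonneg: "0 \<le> slice_weight p"
  by (auto simp: slice_weight_def indicator_def split: prod.split)

lemma slice_weight_integrand:
  fixes F :: "quat \<Rightarrow> 'b::real_vector"
  assumes "I \<in> imag_units"
  shows "indicator {0..2*pi} \<theta> *\<^sub>R (indicator {0..} r *\<^sub>R ((exp (- r\<^sup>2) * r) *\<^sub>R F (r *\<^sub>R exp (\<theta> *\<^sub>R I))))
    = slice_weight (I, \<theta>, r) *\<^sub>R F (slice_point (I, \<theta>, r))"
  by (simp add: slice_weight_def slice_point_def exp_imag_unit[OF assms])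

lemma integrable_gauss_measure_iff:
  fixes F :: "quat \<Rightarrow> 'b::{banach, second_countable_topology}"
  assumes [measurable]: "F \<in> borel_measurable borel"
  shows "integrable gauss_measure F \<longleftrightarrow> integrable slice_space (\<lambda>p. slice_weight p *\<^sub>R F (slice_point p))"
  unfolding gauss_measure_def
  by (subst integrable_distr_eq, simp_all, subst integrable_density) (simp_all add: slice_weight_nonneg)

lemma integral_gauss_measure:
  fixes F :: "quat \<Rightarrow> 'b::{banach, second_countable_topology}"
  assumes [measurable]: "F \<in> borel_measurable borel"
  shows "integral\<^sup>L gauss_measure F = (\<integral>p. slice_weight p *\<^sub>R F (slice_point p) \<partial>slice_space)"
  unfolding gauss_measure_def
  by (subst integral_distr, simp_all, subst integral_density) (simp_all add: slice_weight_nonneg)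

lemma gauss_integrable_iff:
  assumes [measurable]: "F \<in> borel_measurable borel"
  shows "gauss_integrable F \<longleftrightarrow> integrable gauss_measure F"
  unfolding gauss_integrable_def set_integrable_def integrable_gauss_measure_iff[OF assms]
proof (rule Bochner_Integration.integrable_cong)
  fix p assume "p \<in> space slice_space"
  then obtain I \<theta> r where p: "p = (I, \<theta>, r)" "I \<in> imag_units"
    by (auto simp: space_pair_measure)
  show "indicator (imag_units \<times> {0..2*pi} \<times> {0..}) p *\<^sub>R
      (case p of (I, \<theta>, r) \<Rightarrow> (exp (- r\<^sup>2) * r) *\<^sub>R F (r *\<^sub>R exp (\<theta> *\<^sub>R I)))
    = slice_weight p *\<^sub>R F (slice_point p)"
    using slice_weight_integrand[OF p(2), of \<theta> r F] p
    by (simp add: indicator_times mult.assoc)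
qed simp

text \<open>
  Fubini's theorem. It applies to the inner two integrals only for almost every \<open>I\<close>, which suffices
  for the outer one.
\<close>

lemma gauss_integral_eq:
  assumes F: "integrable gauss_measure F"
  shows "gauss_integral F = integral\<^sup>L gauss_measure F"
proof -
  have [measurable]: "F \<in> borel_measurable borel"
    using borel_measurable_integrable[OF F] by simp
  let ?G = "\<lambda>p. slice_weight p *\<^sub>R F (slice_point p)"
  interpret S: prob_space sphere_measure by (rule prob_space_sphere_measure)
  interpret P: pair_sigma_finite sphere_measure "lborel \<Otimes>\<^sub>M lborel :: (real \<times> real) measure" ..
  have G: "integrable slice_space ?G"
    using F by (simp add: integrable_gauss_measure_iff)
  have Gm [measurable]: "?G \<in> borel_measurable slice_space" by measurable
  have "gauss_integral F = (\<integral>I. (\<integral>\<theta>. (\<integral>r. ?G (I, \<theta>, r) \<partial>lborel) \<partial>lborel) \<partial>sphere_measure)"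
    unfolding gauss_integral_def set_lebesgue_integral_def integral_scaleR_right[symmetric]
    by (intro Bochner_Integration.integral_cong refl slice_weight_integrand) simp
  also have "\<dots> = (\<integral>I. (\<integral>y. ?G (I, y) \<partial>(lborel \<Otimes>\<^sub>M lborel)) \<partial>sphere_measure)"
  proof (rule integral_cong_AE)
    show "AE I in sphere_measure. (\<integral>\<theta>. (\<integral>r. ?G (I, \<theta>, r) \<partial>lborel) \<partial>lborel)
        = (\<integral>y. ?G (I, y) \<partial>(lborel \<Otimes>\<^sub>M lborel))"
      using P.AE_integrable_fst'[OF G]
      by eventually_elim (rule lborel_pair.integral_fst')
  qed measurable
  also have "\<dots> = integral\<^sup>L slice_space ?G"
    by (rule P.integral_fst'[OF G])
  finally show ?thesis
    by (simp add: integral_gauss_measure)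
qed

lemma measurable_gauss_measure: "borel_measurable gauss_measure = borel_measurable borel"
  by (rule measurable_cong_sets) simp_all

section \<open>Gaussian moments\<close>

lemma norm_slice_point:
  assumes "I \<in> imag_units" "0 \<le> r"
  shows "norm (slice_point (I, \<theta>, r)) = r"
proof -
  have "(qI I)\<^sup>2 + (qJ I)\<^sup>2 + (qK I)\<^sup>2 = 1"
    using imag_unit_mult_self[OF assms(1)] imag_unit_qRe[OF assms(1)]
    by (simp add: quat_eq_iff power2_eq_square)
  then have "(cos \<theta>)\<^sup>2 + (sin \<theta>)\<^sup>2 * ((qI I)\<^sup>2 + (qJ I)\<^sup>2 + (qK I)\<^sup>2) = 1"
    by simp
  then have "norm (cos \<theta> *\<^sub>R 1 + sin \<theta> *\<^sub>R I) = 1"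
    by (simp add: norm_quat_def imag_unit_qRe[OF assms(1)] power_mult_distrib distrib_left add.assoc)
  then show ?thesis
    using assms(2) by (simp add: slice_point_def)
qed

lemma slice_point_monomial:
  assumes "I \<in> imag_units"
  shows "slice_point (I, \<theta>, r) ^ a * qcnj (slice_point (I, \<theta>, r)) ^ b
    = r ^ (a + b) *\<^sub>R (cos ((real a - real b) * \<theta>) *\<^sub>R 1 + sin ((real a - real b) * \<theta>) *\<^sub>R I)"
proof -
  have 1: "qcnj (slice_point (I, \<theta>, r)) = r *\<^sub>R (cos (- \<theta>) *\<^sub>R 1 + sin (- \<theta>) *\<^sub>R I)"
    by (simp add: slice_point_def quat_eq_iff imag_unit_qRe[OF assms])
  have "slice_point (I, \<theta>, r) ^ a * qcnj (slice_point (I, \<theta>, r)) ^ b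
    = r ^ (a + b) *\<^sub>R ((cos (real a * \<theta>) *\<^sub>R 1 + sin (real a * \<theta>) *\<^sub>R I)
        * (cos (real b * - \<theta>) *\<^sub>R 1 + sin (real b * - \<theta>) *\<^sub>R I))"
    unfolding 1 unfolding slice_point_def case_prod_conv scaleR_power imag_unit_cis_power[OF assms]
    by (simp only: mult_scaleR_left mult_scaleR_right scaleR_scaleR power_add mult.commute[of "r ^ b"])
  also have "\<dots> = r ^ (a + b) *\<^sub>R (cos ((real a - real b) * \<theta>) *\<^sub>R 1 + sin ((real a - real b) * \<theta>) *\<^sub>R I)"
    unfolding imag_unit_cis_mult[OF assms] by (simp add: algebra_simps)
  finally show ?thesis .
qed

lemma integrable_radial_moment:
  "integrable lborel (\<lambda>r::real. indicator {0..} r * (exp (- r\<^sup>2) * r ^ p))"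
proof (cases "even p")
  case True
  then obtain k where "p = 2 * k" by blast
  then show ?thesis
    using has_bochner_integral_integrable[of lborel, THEN has_bochner_integral_iff[THEN iffD1, THEN conjunct1]]
      gaussian_moment_even_pos[of k] by (simp add: has_bochner_integral_iff)
next
  case False
  then obtain k where "p = 2 * k + 1" by (auto elim: oddE)
  then show ?thesis
    using gaussian_moment_odd_pos[of k] by (simp add: has_bochner_integral_iff)
qed

text \<open>
  Unless \<open>k = 0\<close>, the integrand has a primitive of period \<open>2\<pi>\<close> in \<open>\<theta>\<close>.
\<close>

lemma integral_circle_character:
  assumes "k \<in> \<int>"
  shows "(LBINT \<theta>:{0..2*pi}. cos (k * \<theta>) *\<^sub>R (1::quat) + sin (k * \<theta>) *\<^sub>R I)
    = (if k = 0 then (2 * pi) *\<^sub>R 1 else 0)"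
proof -
  let ?F = "\<lambda>\<theta>. if k = 0 then \<theta> *\<^sub>R (1::quat) else (sin (k * \<theta>) / k) *\<^sub>R 1 - (cos (k * \<theta>) / k) *\<^sub>R I"
  have "has_bochner_integral lborel
      (\<lambda>\<theta>. indicator {0..2*pi} \<theta> *\<^sub>R (cos (k * \<theta>) *\<^sub>R (1::quat) + sin (k * \<theta>) *\<^sub>R I)) (?F (2 * pi) - ?F 0)"
  proof (rule has_bochner_integral_FTC_Icc)
    fix x :: real
    show "(?F has_vector_derivative cos (k * x) *\<^sub>R 1 + sin (k * x) *\<^sub>R I) (at x within {0..2 * pi})"
      by (cases "k = 0") (auto intro!: derivative_eq_intros)
  qed (auto intro!: continuous_intros)
  moreover have "sin (k * (2 * pi)) = 0" "cos (k * (2 * pi)) = 1"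
    using assms sin_integer_2pi[of k] cos_integer_2pi[of k] by (simp_all add: mult_ac)
  ultimately show ?thesis
    by (auto simp: set_lebesgue_integral_def has_bochner_integral_iff)
qed

text \<open>
  In polar coordinates the integrand is a product of a function of \<open>\<theta>\<close> and a function of \<open>r\<close>.
\<close>

lemma integrable_gauss_norm_power: "integrable gauss_measure (\<lambda>q. norm q ^ p)"
proof -
  let ?h = "\<lambda>r. indicator {0..} r * (exp (- r\<^sup>2) * r ^ Suc p) :: real"
  let ?g = "\<lambda>y. indicator {0..2*pi} (fst y) * ?h (snd y) :: real"
  interpret S: prob_space sphere_measure by (rule prob_space_sphere_measure)
  interpret P: pair_sigma_finite sphere_measure "lborel \<Otimes>\<^sub>M lborel :: (real \<times> real) measure" ..
  have h0: "0 \<le> ?h r" for r by (simp add: indicator_def)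
  have g: "integrable (lborel \<Otimes>\<^sub>M lborel) ?g"
  proof (rule lborel_pair.Fubini_integrable)
    show "integrable lborel (\<lambda>\<theta>. \<integral>r. norm (?g (\<theta>, r)) \<partial>lborel)"
      using h0 by (simp add: abs_mult)
    show "AE \<theta> in lborel. integrable lborel (\<lambda>r. ?g (\<theta>, r))"
      unfolding fst_conv snd_conv by (intro AE_I2 integrable_mult_right integrable_radial_moment)
  qed simp
  have "integrable slice_space (\<lambda>x. ?g (snd x))"
    by (rule P.Fubini_integrable) (use g in auto)
  also have "?this \<longleftrightarrow> integrable slice_space (\<lambda>p'. slice_weight p' *\<^sub>R norm (slice_point p') ^ p)"
  proof (rule Bochner_Integration.integrable_cong)
    fix x assume "x \<in> space slice_space"
    then obtain I \<theta> r where x: "x = (I, \<theta>, r)" "I \<in> imag_units"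
      by (auto simp: space_pair_measure)
    then show "?g (snd x) = slice_weight x *\<^sub>R norm (slice_point x) ^ p"
      by (cases "0 \<le> r") (auto simp: norm_slice_point slice_weight_def)
  qed simp
  finally show ?thesis
    by (simp add: integrable_gauss_measure_iff)
qed

text \<open>
  The integral over \<open>r\<close> contributes a constant, and the integral over \<open>\<theta>\<close> is that of a character of the
  circle. The outcome does not depend on \<open>I\<close>, so averaging over the sphere changes nothing.
\<close>

lemma gauss_moment:
  shows integrable_gauss_monomial: "integrable gauss_measure (\<lambda>q. q ^ a * qcnj q ^ b)"
    and integral_gauss_monomial:
      "(\<integral>q. q ^ a * qcnj q ^ b \<partial>gauss_measure) = (if a = b then (pi * fact a) *\<^sub>R 1 else 0)"
proof -
  have [measurable]: "(\<lambda>q. q ^ a * qcnj q ^ b) \<in> borel_measurable borel"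
    by (intro borel_measurable_continuous_onI continuous_intros)
  show int: "integrable gauss_measure (\<lambda>q. q ^ a * qcnj q ^ b)"
    by (rule Bochner_Integration.integrable_bound[OF integrable_gauss_norm_power[of "a + b"]])
      (simp_all add: norm_mult norm_power power_add measurable_gauss_measure)
  interpret S: prob_space sphere_measure by (rule prob_space_sphere_measure)
  define k where "k = real a - real b"
  define e where "e = (\<lambda>I \<theta>. cos (k * \<theta>) *\<^sub>R (1::quat) + sin (k * \<theta>) *\<^sub>R I)"
  define K :: real where "K = (\<integral>r. indicator {0..} r * (exp (- r\<^sup>2) * r ^ (a + b + 1)) \<partial>lborel)"
  have r: "(LBINT r:{0..}. (exp (- r\<^sup>2) * r) *\<^sub>R ((r *\<^sub>R exp (\<theta> *\<^sub>R I)) ^ a * qcnj (r *\<^sub>R exp (\<theta> *\<^sub>R I)) ^ b))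
      = K *\<^sub>R e I \<theta>" if "I \<in> imag_units" for I \<theta>
  proof -
    have "(r *\<^sub>R exp (\<theta> *\<^sub>R I)) ^ a * qcnj (r *\<^sub>R exp (\<theta> *\<^sub>R I)) ^ b = r ^ (a + b) *\<^sub>R e I \<theta>" for r
      using slice_point_monomial[OF that, of \<theta> r a b]
      by (simp add: slice_point_def exp_imag_unit[OF that] e_def k_def)
    then have "(LBINT r:{0..}. (exp (- r\<^sup>2) * r) *\<^sub>R ((r *\<^sub>R exp (\<theta> *\<^sub>R I)) ^ a * qcnj (r *\<^sub>R exp (\<theta> *\<^sub>R I)) ^ b))
        = (\<integral>r. (indicator {0..} r * (exp (- r\<^sup>2) * r ^ (a + b + 1))) *\<^sub>R e I \<theta> \<partial>lborel)"
      by (simp add: set_lebesgue_integral_def mult_ac)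
    also have "\<dots> = K *\<^sub>R e I \<theta>"
      unfolding K_def by (rule integral_scaleR_left) (rule integrable_radial_moment)
    finally show ?thesis .
  qed
  have "k \<in> \<int>" by (simp add: k_def)
  have "(\<integral>q. q ^ a * qcnj q ^ b \<partial>gauss_measure) = gauss_integral (\<lambda>q. q ^ a * qcnj q ^ b)"
    by (rule gauss_integral_eq[OF int, symmetric])
  also have "\<dots> = (\<integral>I. K *\<^sub>R (LBINT \<theta>:{0..2*pi}. e I \<theta>) \<partial>sphere_measure)"
    unfolding gauss_integral_def
    by (intro Bochner_Integration.integral_cong refl) (simp only: space_sphere_measure r set_integral_scaleR_right)
  also have "\<dots> = K *\<^sub>R (if k = 0 then (2 * pi) *\<^sub>R 1 else 0)"
    unfolding e_def integral_circle_character[OF \<open>k \<in> \<int>\<close>] using S.prob_space by simp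
  also have "\<dots> = (if a = b then (pi * fact a) *\<^sub>R 1 else 0)"
  proof (cases "a = b")
    case True
    then have "K = fact a / 2"
      using gaussian_moment_odd_pos[of a]
      by (simp add: K_def has_bochner_integral_iff mult_2)
    then show ?thesis using True by (simp add: k_def)
  qed (simp add: k_def)
  finally show "(\<integral>q. q ^ a * qcnj q ^ b \<partial>gauss_measure) = (if a = b then (pi * fact a) *\<^sub>R 1 else 0)" .
qed

section \<open>Coefficients of the Hermite polynomials\<close>

text \<open>
  Such a sum is an \<open>m\<close>-th finite difference of \<open>g\<close>, and Pascal's rule says that the next difference is the
  difference of two consecutive ones.
\<close>

lemma alternating_binomial_sum_Suc:
  fixes g :: "nat \<Rightarrow> real"
  shows "(\<Sum>j\<le>Suc m. (- 1) ^ j * real (Suc m choose j) * g j)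
    = (\<Sum>j\<le>m. (- 1) ^ j * real (m choose j) * g j)
      - (\<Sum>j\<le>m. (- 1) ^ j * real (m choose j) * g (Suc j))"
proof -
  let ?t = "\<lambda>j. (- 1) ^ j * real (m choose j) * g j"
  have "(\<Sum>j\<le>Suc m. (- 1) ^ j * real (Suc m choose j) * g j)
      = g 0 + (\<Sum>j\<le>m. (- 1) ^ Suc j * real (Suc m choose Suc j) * g (Suc j))"
    by (subst sum.atMost_Suc_shift) simp
  also have "(\<Sum>j\<le>m. (- 1) ^ Suc j * real (Suc m choose Suc j) * g (Suc j))
      = (\<Sum>j\<le>m. ?t (Suc j)) - (\<Sum>j\<le>m. (- 1) ^ j * real (m choose j) * g (Suc j))"
    unfolding sum_subtractf[symmetric] by (intro sum.cong refl) (simp add: algebra_simps)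
  also have "g 0 + (\<dots>) = (\<Sum>j\<le>Suc m. ?t j) - (\<Sum>j\<le>m. (- 1) ^ j * real (m choose j) * g (Suc j))"
    by (subst sum.atMost_Suc_shift) simp
  also have "(\<Sum>j\<le>Suc m. ?t j) = (\<Sum>j\<le>m. ?t j)"
    by simp
  finally show ?thesis .
qed

text \<open>
  Each difference lowers the binomial degree of \<open>(N - j choose k)\<close> by one (Pascal's rule again); the
  \<open>m\<close>-th one annihilates it as soon as \<open>k < m\<close>.
\<close>

lemma alternating_binomial_sum_choose:
  assumes "m \<le> N"
  shows "(\<Sum>j\<le>m. (- 1) ^ j * real (m choose j) * real ((N - j) choose k))
    = (if k < m then 0 else real ((N - m) choose (k - m)))"
  using assms
proof (induction m arbitrary: N)
  case 0
  show ?case by simp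
next
  case (Suc m)
  then obtain M where N: "N = Suc M" and M: "m \<le> M"
    by (cases N) auto
  have pascal: "real ((Suc M - m) choose (k - m)) = real ((M - m) choose (k - m)) + real ((M - m) choose (k - Suc m))"
    if "m < k"
  proof -
    from that obtain i where "k - m = Suc i" "k - Suc m = i"
      by (metis Suc_diff_Suc)
    then show ?thesis using M by (simp add: Suc_diff_le)
  qed
  have "(\<Sum>j\<le>Suc m. (- 1) ^ j * real (Suc m choose j) * real ((N - j) choose k))
    = (if k < m then 0 else real ((Suc M - m) choose (k - m)))
      - (if k < m then 0 else real ((M - m) choose (k - m)))"
    using Suc.IH[of "Suc M"] Suc.IH[of M] M
    by (simp only: alternating_binomial_sum_Suc) (simp add: N)
  also have "\<dots> = (if k < Suc m then 0 else real ((N - Suc m) choose (k - Suc m)))"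
    using pascal M by (auto simp: N not_less less_Suc_eq Suc_diff_le)
  finally show ?case .
qed

definition hermite_coeff :: "nat \<Rightarrow> nat \<Rightarrow> nat \<Rightarrow> real"
  where "hermite_coeff m n j = (- 1) ^ j * (fact m * fact n) / (fact j * fact (m - j) * fact (n - j))"

lemma hermite_coeff_commute: "hermite_coeff m n j = hermite_coeff n m j"
  by (simp add: hermite_coeff_def mult_ac)

lemma hermite_coeff_0 [simp]: "hermite_coeff m n 0 = 1"
  by (simp add: hermite_coeff_def)

text \<open>
  The factorials combine so that, up to a factor independent of \<open>j\<close>, the left-hand side is the \<open>m\<close>-th difference of
  \<open>(m + n - i - j choose m - i)\<close>, a polynomial of degree \<open>m - i\<close> in \<open>j\<close>. Only \<open>i = 0\<close> survives.
\<close>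

lemma hermite_coeff_moment_sum_aux:
  assumes "m \<le> n" "i \<le> m"
  shows "(\<Sum>j\<le>m. hermite_coeff m n j * fact (m + n - i - j)) = (if i = 0 then fact m * fact n else 0)"
proof -
  have "hermite_coeff m n j * fact (m + n - i - j)
      = fact n * fact (m - i) * ((- 1) ^ j * real (m choose j) * real ((m + n - i - j) choose (m - i)))"
    if "j \<le> m" for j
  proof -
    have "m + n - i - j - (m - i) = n - j" "m - i \<le> m + n - i - j"
      using assms that by auto
    then have "real ((m + n - i - j) choose (m - i)) = fact (m + n - i - j) / (fact (m - i) * fact (n - j))"
      by (simp add: binomial_fact)
    then show ?thesis
      using that by (simp add: hermite_coeff_def binomial_fact mult_ac)
  qed
  then have "(\<Sum>j\<le>m. hermite_coeff m n j * fact (m + n - i - j))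
      = fact n * fact (m - i) * (\<Sum>j\<le>m. (- 1) ^ j * real (m choose j) * real ((m + n - i - j) choose (m - i)))"
    unfolding sum_distrib_left by (intro sum.cong) auto
  also have "\<dots> = (if i = 0 then fact m * fact n else 0)"
    using alternating_binomial_sum_choose[of m "m + n - i" "m - i"] assms by auto
  finally show ?thesis .
qed

text \<open>
  The coefficients are symmetric in \<open>m\<close> and \<open>n\<close>, so either index may play the part of the smaller one.
\<close>

lemma hermite_coeff_moment_sum:
  assumes "i \<le> min m n"
  shows "(\<Sum>j\<le>min m n. hermite_coeff m n j * fact (m + n - i - j)) = (if i = 0 then fact m * fact n else 0)"
proof (cases "m \<le> n")
  case True
  then show ?thesis
    using hermite_coeff_moment_sum_aux[of m n i] assms by simp
next
  case False
  then show ?thesis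
    using hermite_coeff_moment_sum_aux[of n m i] assms
    by (simp add: hermite_coeff_commute[of m n] add.commute mult.commute)
qed

text \<open>
  The double sum that remains of \<open>\<parallel>H\<^sub>m\<^sub>,\<^sub>n\<parallel>\<^sup>2\<close> after all monomials have been integrated, without the
  factor \<open>\<pi>\<close>. The inner sum vanishes except at \<open>i = 0\<close>.
\<close>

lemma hermite_coeff_norm_sum:
  "(\<Sum>i\<le>min m n. \<Sum>j\<le>min m n. hermite_coeff m n i * hermite_coeff m n j * fact (m + n - i - j)) = fact m * fact n"
proof -
  have "(\<Sum>i\<le>min m n. \<Sum>j\<le>min m n. hermite_coeff m n i * hermite_coeff m n j * fact (m + n - i - j))
    = (\<Sum>i\<le>min m n. hermite_coeff m n i * (\<Sum>j\<le>min m n. hermite_coeff m n j * fact (m + n - i - j)))"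
    by (simp add: sum_distrib_left mult.assoc)
  also have "\<dots> = (\<Sum>i\<le>min m n. hermite_coeff m n i * (if i = 0 then fact m * fact n else 0))"
    by (intro sum.cong refl) (simp only: hermite_coeff_moment_sum atMost_iff)
  also have "\<dots> = fact m * fact n"
    by (simp add: if_distrib sum.delta cong: if_cong)
  finally show ?thesis .
qed

text \<open>
  For fixed \<open>m\<close> the growth in \<open>n\<close> is polynomial: the only factor that grows is the falling factorial
  \<open>n! / (n - j)!\<close>, at most \<open>n\<^sup>j\<close>.
\<close>

lemma abs_hermite_coeff_le:
  assumes "j \<le> min n m"
  shows "\<bar>hermite_coeff n m j\<bar> \<le> real (m choose j) * real n ^ j"
proof -
  have "real ((n choose j) * fact j) \<le> real (n ^ j)"
    by (rule of_nat_mono) (rule binomial_fact_pow)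
  then have *: "real (n choose j) * fact j \<le> real n ^ j"
    by simp
  have "\<bar>hermite_coeff n m j\<bar> = real (m choose j) * (real (n choose j) * fact j)"
    using assms by (simp add: hermite_coeff_def binomial_fact abs_mult mult_ac)
  also have "\<dots> \<le> real (m choose j) * real n ^ j"
    by (intro mult_left_mono *) simp
  finally show ?thesis .
qed

section \<open>Orthogonality of the Hermite polynomials\<close>

lemma quat_hermite_eq:
  "quat_hermite n m q = (\<Sum>j\<le>min n m. hermite_coeff n m j *\<^sub>R (q ^ (n - j) * qcnj q ^ (m - j)))"
  unfolding quat_hermite_def scaleR_sum_right atLeast0AtMost
  by (intro sum.cong refl) (simp add: hermite_coeff_def divide_inverse mult_ac)

lemma continuous_on_quat_hermite [continuous_intros]: "continuous_on S (quat_hermite n m)"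
  unfolding quat_hermite_eq[abs_def] by (intro continuous_intros)

lemma borel_measurable_quat_hermite [measurable]: "quat_hermite n m \<in> borel_measurable borel"
  by (intro borel_measurable_continuous_onI continuous_intros)

text \<open>
  All monomials in \<open>q\<close> and its conjugate commute, so the product can again be sorted into such
  monomials, ready for the moment formula.
\<close>

lemma qcnj_hermite_mult_hermite:
  "qcnj (quat_hermite n m q) * quat_hermite k m q
    = (\<Sum>i\<le>min n m. \<Sum>j\<le>min k m. (hermite_coeff n m i * hermite_coeff k m j) *\<^sub>R
        (q ^ (m - i + (k - j)) * qcnj q ^ (n - i + (m - j))))"
proof -
  have "q ^ b * qcnj q ^ a * (q ^ c * qcnj q ^ d) = q ^ (b + c) * qcnj q ^ (a + d)" for a b c d :: nat
  proof -
    have "qcnj q ^ a * q ^ c = q ^ c * qcnj q ^ a"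
      by (metis power_commuting_commutes qcnj_mult_commute)
    then show ?thesis
      by (metis mult.assoc power_add)
  qed
  then show ?thesis
    unfolding quat_hermite_eq by (simp add: qcnj_sum sum_product mult.commute)
qed

text \<open>
  In every term the exponents of \<open>q\<close> and its conjugate differ by \<open>k - n\<close>, whatever \<open>i\<close> and \<open>j\<close> are; hence
  all terms vanish together when \<open>n \<noteq> k\<close>.
\<close>

lemma
  shows integrable_hermite_inner:
      "integrable gauss_measure (\<lambda>q. qcnj (quat_hermite n m q) * quat_hermite k m q)"
    and integral_hermite_inner:
      "(\<integral>q. qcnj (quat_hermite n m q) * quat_hermite k m q \<partial>gauss_measure)
        = (if n = k then (pi * fact m * fact n) *\<^sub>R 1 else 0)"
proof -
  let ?c = "\<lambda>i j. hermite_coeff n m i * hermite_coeff k m j"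
  show "integrable gauss_measure (\<lambda>q. qcnj (quat_hermite n m q) * quat_hermite k m q)"
    unfolding qcnj_hermite_mult_hermite
    by (intro Bochner_Integration.integrable_sum integrable_scaleR_right integrable_gauss_monomial)
  have "(\<integral>q. qcnj (quat_hermite n m q) * quat_hermite k m q \<partial>gauss_measure)
      = (\<Sum>i\<le>min n m. \<Sum>j\<le>min k m. ?c i j *\<^sub>R
          (\<integral>q. q ^ (m - i + (k - j)) * qcnj q ^ (n - i + (m - j)) \<partial>gauss_measure))"
    unfolding qcnj_hermite_mult_hermite
    by (simp add: integrable_gauss_monomial Bochner_Integration.integral_sum)
  also have "\<dots> = (\<Sum>i\<le>min n m. \<Sum>j\<le>min k m. ?c i j *\<^sub>R
      (if n = k then (pi * fact (m + n - i - j)) *\<^sub>R 1 else 0))"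
  proof (intro sum.cong refl)
    fix i j assume "i \<in> {..min n m}" "j \<in> {..min k m}"
    then have "m - i + (k - j) = n - i + (m - j) \<longleftrightarrow> n = k" "n = k \<Longrightarrow> m - i + (k - j) = m + n - i - j"
      by auto
    then show "?c i j *\<^sub>R (\<integral>q. q ^ (m - i + (k - j)) * qcnj q ^ (n - i + (m - j)) \<partial>gauss_measure)
      = ?c i j *\<^sub>R (if n = k then (pi * fact (m + n - i - j)) *\<^sub>R 1 else 0)"
      unfolding integral_gauss_monomial by simp
  qed
  also have "\<dots> = (if n = k then (pi * fact m * fact n) *\<^sub>R 1 else 0)"
  proof (cases "n = k")
    case True
    have "(\<Sum>i\<le>min n m. \<Sum>j\<le>min n m. (hermite_coeff n m i * hermite_coeff n m j) *\<^sub>R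
        ((pi * fact (n + m - i - j)) *\<^sub>R (1::quat)))
      = (pi * (\<Sum>i\<le>min n m. \<Sum>j\<le>min n m. hermite_coeff n m i * hermite_coeff n m j * fact (n + m - i - j))) *\<^sub>R 1"
      by (simp add: scaleR_sum_left sum_distrib_left mult_ac)
    also have "\<dots> = (pi * fact m * fact n) *\<^sub>R 1"
      by (simp only: hermite_coeff_norm_sum) (simp only: mult_ac)
    finally show ?thesis
      using True by (simp add: add.commute)
  qed simp
  finally show "(\<integral>q. qcnj (quat_hermite n m q) * quat_hermite k m q \<partial>gauss_measure)
        = (if n = k then (pi * fact m * fact n) *\<^sub>R 1 else 0)" .
qed

section \<open>Pointwise convergence of Hermite series\<close>

text \<open>
  By the binomial theorem the coefficient bounds add up to \<open>(n + 1)\<^sup>m\<close>.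
\<close>

lemma norm_quat_hermite_le:
  "norm (quat_hermite n m q) \<le> real (Suc n) ^ m * max 1 (norm q) ^ (n + m)"
proof -
  let ?R = "max 1 (norm q)"
  have "norm (quat_hermite n m q) \<le> (\<Sum>j\<le>min n m. \<bar>hermite_coeff n m j\<bar> * norm q ^ (n - j + (m - j)))"
    unfolding quat_hermite_eq
    by (rule order_trans[OF norm_sum])
      (simp only: norm_scaleR norm_mult norm_power norm_qcnj power_add order.refl)
  also have "\<dots> \<le> (\<Sum>j\<le>min n m. real (m choose j) * real n ^ j * ?R ^ (n + m))"
  proof (intro sum_mono mult_mono)
    fix j assume j: "j \<in> {..min n m}"
    then show "\<bar>hermite_coeff n m j\<bar> \<le> real (m choose j) * real n ^ j"
      by (intro abs_hermite_coeff_le) simp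
    have "norm q ^ (n - j + (m - j)) \<le> ?R ^ (n - j + (m - j))"
      by (intro power_mono) simp_all
    also have "\<dots> \<le> ?R ^ (n + m)"
      by (intro power_increasing) simp_all
    finally show "norm q ^ (n - j + (m - j)) \<le> ?R ^ (n + m)" .
  qed simp_all
  also have "\<dots> \<le> (\<Sum>j\<le>m. real (m choose j) * real n ^ j * ?R ^ (n + m))"
    by (intro sum_mono2) auto
  also have "\<dots> = real (Suc n) ^ m * ?R ^ (n + m)"
    using binomial_ring[of "real n" 1 m] by (simp add: sum_distrib_right add.commute)
  finally show ?thesis .
qed

text \<open>
  The reproducing kernel is finite on the diagonal: \<open>(n + 1)\<^sup>2\<^sup>m \<le> (2m)! exp (n + 1)\<close> turns the
  polynomial growth of the previous bound into a geometric factor, and an exponential series remains.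
\<close>

lemma summable_norm_quat_hermite_sq: "summable (\<lambda>n. (norm (quat_hermite n m q))\<^sup>2 / fact n)"
proof -
  let ?R = "max 1 (norm q)"
  let ?A = "fact (2 * m) * exp 1 * ?R ^ (2 * m)"
  have "norm ((norm (quat_hermite n m q))\<^sup>2 / fact n) \<le> ?A * ((exp 1 * ?R\<^sup>2) ^ n /\<^sub>R fact n)" for n
  proof -
    \<comment> \<open>a single term of the exponential series is at most its sum\<close>
    have "real (Suc n) ^ (2 * m) / fact (2 * m) \<le> exp (real (Suc n))"
    proof -
      have "(\<Sum>k\<in>{2 * m}. real (Suc n) ^ k /\<^sub>R fact k) \<le> (\<Sum>k. real (Suc n) ^ k /\<^sub>R fact k)"
        by (intro sum_le_suminf summable_exp_generic) auto
      then show ?thesis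
        by (simp add: exp_def divide_inverse mult.commute)
    qed
    then have *: "real (Suc n) ^ (2 * m) \<le> fact (2 * m) * exp (real (Suc n))"
      by (simp add: field_simps)
    have "(norm (quat_hermite n m q))\<^sup>2 \<le> (real (Suc n) ^ m * ?R ^ (n + m))\<^sup>2"
      by (intro power_mono norm_quat_hermite_le) simp
    also have "\<dots> = real (Suc n) ^ (2 * m) * ?R ^ (2 * (n + m))"
      by (simp add: power_mult_distrib power_mult[symmetric] mult.commute del: of_nat_Suc)
    also have "\<dots> \<le> (fact (2 * m) * exp (real (Suc n))) * ?R ^ (2 * (n + m))"
      by (intro mult_right_mono *) simp
    also have "\<dots> = ?A * (exp 1 * ?R\<^sup>2) ^ n"
      by (simp add: exp_add exp_of_nat_mult[symmetric] power_mult_distrib power_add power_mult[symmetric]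
          distrib_left mult_ac)
    finally show ?thesis
      by (simp add: divide_inverse mult_ac mult_right_mono)
  qed
  then show ?thesis
    by (intro summable_comparison_test'[OF summable_mult[OF summable_exp_generic]])
qed

text \<open>
  The Cauchy-Schwarz inequality with weights \<open>1 / n!\<close> and \<open>n!\<close>, in the pointwise form
  \<open>2 x y \<le> x\<^sup>2 + y\<^sup>2\<close>.
\<close>

lemma summable_quat_hermite_series:
  assumes "summable (\<lambda>n. fact n * (norm (C n))\<^sup>2)"
  shows "summable (\<lambda>n. quat_hermite n m q * C n)"
proof (rule summable_norm_cancel, rule summable_comparison_test')
  show "summable (\<lambda>n. (norm (quat_hermite n m q))\<^sup>2 / fact n + fact n * (norm (C n))\<^sup>2)"
    by (intro summable_add summable_norm_quat_hermite_sq assms)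
  fix n
  let ?h = "norm (quat_hermite n m q)" and ?c = "norm (C n)" and ?s = "sqrt (fact n)"
  have "?h * ?c = (?h / ?s) * (?s * ?c)"
    by simp
  also have "\<dots> \<le> 2 * ((?h / ?s) * (?s * ?c))"
    by simp
  also have "\<dots> \<le> (?h / ?s)\<^sup>2 + (?s * ?c)\<^sup>2"
    using sum_squares_bound[of "?h / ?s" "?s * ?c"] by (simp only: mult.assoc)
  also have "\<dots> = ?h\<^sup>2 / fact n + fact n * ?c\<^sup>2"
    by (simp add: power_divide power_mult_distrib)
  finally show "norm (norm (quat_hermite n m q * C n)) \<le> ?h\<^sup>2 / fact n + fact n * ?c\<^sup>2"
    by (simp add: norm_mult)
qed

section \<open>Square-integrable quaternionic functions\<close>

text \<open>
  Fatou's lemma for \<open>L\<^sup>2\<close> norms.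
\<close>

lemma nn_integral_norm_sq_limit_le:
  fixes u :: "nat \<Rightarrow> 'a \<Rightarrow> 'b::{real_normed_vector, second_countable_topology}"
  assumes [measurable]: "\<And>k. u k \<in> borel_measurable M"
    and lim: "\<And>x. (\<lambda>k. u k x) \<longlonglongrightarrow> f x"
    and le: "\<And>k. (\<integral>\<^sup>+x. ennreal ((norm (u k x))\<^sup>2) \<partial>M) \<le> K"
  shows "(\<integral>\<^sup>+x. ennreal ((norm (f x))\<^sup>2) \<partial>M) \<le> K"
proof -
  have "(\<integral>\<^sup>+x. ennreal ((norm (f x))\<^sup>2) \<partial>M) = (\<integral>\<^sup>+x. liminf (\<lambda>k. ennreal ((norm (u k x))\<^sup>2)) \<partial>M)"
    by (intro nn_integral_cong sym[OF lim_imp_Liminf] tendsto_intros lim) simp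
  also have "\<dots> \<le> liminf (\<lambda>k. \<integral>\<^sup>+x. ennreal ((norm (u k x))\<^sup>2) \<partial>M)"
    by (rule nn_integral_liminf) measurable
  also have "\<dots> \<le> limsup (\<lambda>k. \<integral>\<^sup>+x. ennreal ((norm (u k x))\<^sup>2) \<partial>M)"
    by (rule Liminf_le_Limsup) simp
  also have "\<dots> \<le> K"
    by (rule Limsup_bounded) (simp add: le)
  finally show ?thesis .
qed

text \<open>
  The Cauchy-Schwarz inequality, applied to the norms because \<open>|f\<^sup>* g| = |f| |g|\<close>.
\<close>

lemma L2_qcnj_mult:
  fixes f g :: "'a \<Rightarrow> quat"
  assumes [measurable]: "f \<in> borel_measurable M" "g \<in> borel_measurable M"
    and f: "(\<integral>\<^sup>+x. ennreal ((norm (f x))\<^sup>2) \<partial>M) \<le> ennreal A"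
    and g: "(\<integral>\<^sup>+x. ennreal ((norm (g x))\<^sup>2) \<partial>M) \<le> ennreal B"
    and AB: "0 \<le> A" "0 \<le> B"
  shows L2_integrable_qcnj_mult: "integrable M (\<lambda>x. qcnj (f x) * g x)"
    and L2_norm_integral_qcnj_mult_le: "norm (\<integral>x. qcnj (f x) * g x \<partial>M) \<le> sqrt (A * B)"
proof -
  have [measurable]: "(\<lambda>x. qcnj (f x)) \<in> borel_measurable M"
    by (rule measurable_compose[OF _ borel_measurable_qcnj]) measurable
  define T where "T = (\<integral>\<^sup>+x. ennreal (norm (qcnj (f x) * g x)) \<partial>M)"
  have "T\<^sup>2 \<le> (\<integral>\<^sup>+x. (ennreal (norm (f x)))\<^sup>2 \<partial>M) * (\<integral>\<^sup>+x. (ennreal (norm (g x)))\<^sup>2 \<partial>M)"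
    using Cauchy_Schwarz_nn_integral[of "\<lambda>x. ennreal (norm (f x))" M "\<lambda>x. ennreal (norm (g x))"]
    by (simp add: T_def norm_mult ennreal_mult)
  also have "\<dots> \<le> ennreal A * ennreal B"
    using mult_mono[OF f g] by (simp add: ennreal_power)
  also have "\<dots> = ennreal (A * B)"
    using AB by (simp add: ennreal_mult)
  finally have T2: "T\<^sup>2 \<le> ennreal (A * B)" .
  then have "T \<noteq> \<infinity>"
    by (auto simp: top_unique power2_eq_square)
  then obtain t where t: "T = ennreal t" "0 \<le> t"
    by (cases T) auto
  with T2 AB have "t\<^sup>2 \<le> A * B"
    by (simp add: ennreal_power)
  then have "t \<le> sqrt (A * B)"
    by (rule real_le_rsqrt)
  show int: "integrable M (\<lambda>x. qcnj (f x) * g x)"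
    using t by (intro integrableI_bounded) (simp_all add: T_def)
  have "ennreal (norm (\<integral>x. qcnj (f x) * g x \<partial>M)) \<le> T"
    unfolding T_def by (rule integral_norm_bound_ennreal[OF int])
  with t \<open>t \<le> sqrt (A * B)\<close> show "norm (\<integral>x. qcnj (f x) * g x \<partial>M) \<le> sqrt (A * B)"
    by simp
qed

section \<open>Hermite expansions and Parseval's identity\<close>

definition hermite_weight :: "nat \<Rightarrow> nat \<Rightarrow> real"
  where "hermite_weight m n = pi * fact m * fact n"

lemma hermite_weight_pos: "0 < hermite_weight m n"
  by (simp add: hermite_weight_def)

text \<open>
  The coefficients stand on the right of the polynomials, so in the sesquilinear product they end up on
  the two outer sides and leave the integral; noncommutativity is harmless.
\<close>

lemma integral_hermite_sum_inner:
  fixes C D :: "nat \<Rightarrow> quat"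
  assumes "finite A"
  shows "integrable gauss_measure
      (\<lambda>q. qcnj (\<Sum>n\<in>A. quat_hermite n m q * C n) * (\<Sum>n\<in>A. quat_hermite n m q * D n))" (is ?int)
    and "(\<integral>q. qcnj (\<Sum>n\<in>A. quat_hermite n m q * C n) * (\<Sum>n\<in>A. quat_hermite n m q * D n) \<partial>gauss_measure)
      = (\<Sum>n\<in>A. hermite_weight m n *\<^sub>R (qcnj (C n) * D n))" (is ?eq)
proof -
  have expand: "qcnj (\<Sum>n\<in>A. quat_hermite n m q * C n) * (\<Sum>n\<in>A. quat_hermite n m q * D n)
    = (\<Sum>n\<in>A. \<Sum>k\<in>A. qcnj (C n) * ((qcnj (quat_hermite n m q) * quat_hermite k m q) * D k))" for q
    by (simp add: qcnj_sum sum_product mult.assoc)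
  have int: "integrable gauss_measure
      (\<lambda>q. qcnj (C n) * ((qcnj (quat_hermite n m q) * quat_hermite k m q) * D k))" for n k
    by (intro integrable_mult_left integrable_mult_right integrable_hermite_inner)
  show ?int
    unfolding expand by (intro Bochner_Integration.integrable_sum int)
  have "(\<integral>q. qcnj (C n) * ((qcnj (quat_hermite n m q) * quat_hermite k m q) * D k) \<partial>gauss_measure)
      = (if k = n then hermite_weight m n *\<^sub>R (qcnj (C n) * D n) else 0)" for n k
    by (subst Bochner_Integration.integral_mult_right, intro integrable_mult_left integrable_hermite_inner,
        subst Bochner_Integration.integral_mult_left, rule integrable_hermite_inner)
      (simp add: integral_hermite_inner hermite_weight_def)
  then show ?eq
    unfolding expand using assms by (simp add: Bochner_Integration.integral_sum int)
qed

lemma nn_integral_hermite_sum_norm_sq: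
  fixes C :: "nat \<Rightarrow> quat"
  assumes "finite A"
  shows "(\<integral>\<^sup>+q. ennreal ((norm (\<Sum>n\<in>A. quat_hermite n m q * C n))\<^sup>2) \<partial>gauss_measure)
    = ennreal (\<Sum>n\<in>A. hermite_weight m n * (norm (C n))\<^sup>2)"
proof -
  let ?p = "\<lambda>q. \<Sum>n\<in>A. quat_hermite n m q * C n"
  have "integrable gauss_measure (\<lambda>q. (norm (?p q))\<^sup>2 *\<^sub>R (1::quat))"
    using integral_hermite_sum_inner(1)[OF assms, of m C C] by (simp only: qcnj_mult_self)
  then have int: "integrable gauss_measure (\<lambda>q. (norm (?p q))\<^sup>2)"
    using integrable_norm by fastforce
  have "(\<integral>q. (norm (?p q))\<^sup>2 \<partial>gauss_measure) *\<^sub>R (1::quat)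
      = (\<integral>q. (norm (?p q))\<^sup>2 *\<^sub>R 1 \<partial>gauss_measure)"
    using int by simp
  also have "\<dots> = (\<Sum>n\<in>A. hermite_weight m n * (norm (C n))\<^sup>2) *\<^sub>R 1"
    using integral_hermite_sum_inner(2)[OF assms, of m C C]
    by (simp only: qcnj_mult_self scaleR_scaleR scaleR_sum_left)
  finally have "(\<integral>q. (norm (?p q))\<^sup>2 \<partial>gauss_measure) = (\<Sum>n\<in>A. hermite_weight m n * (norm (C n))\<^sup>2)"
    by simp
  then show ?thesis
    using int by (simp add: nn_integral_eq_integral)
qed

text \<open>
  The relation between a member of the space and a coefficient sequence, so that both can be named in
  the statements about inner products.
\<close>

definition hermite_expansion :: "nat \<Rightarrow> (quat \<Rightarrow> quat) \<Rightarrow> (nat \<Rightarrow> quat) \<Rightarrow> bool"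
  where "hermite_expansion m f C \<longleftrightarrow>
    summable (\<lambda>n. hermite_weight m n * (norm (C n))\<^sup>2) \<and> (\<forall>q. (\<lambda>n. quat_hermite n m q * C n) sums f q)"

lemma gen_bargmann_iff: "f \<in> gen_bargmann m \<longleftrightarrow> (\<exists>C. hermite_expansion m f C)"
  by (simp add: gen_bargmann_def hermite_expansion_def hermite_weight_def mult.assoc)

lemma hermite_expansion_measurable:
  assumes "hermite_expansion m f C"
  shows "f \<in> borel_measurable borel"
proof (rule borel_measurable_LIMSEQ_metric)
  show "(\<lambda>q. \<Sum>n<N. quat_hermite n m q * C n) \<in> borel_measurable borel" for N
    by measurable
  show "(\<lambda>N. \<Sum>n<N. quat_hermite n m q * C n) \<longlonglongrightarrow> f q" for q
    using assms by (simp add: hermite_expansion_def sums_def)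
qed

text \<open>
  The remainder is the pointwise limit of the finite sections \<open>N \<le> n < N + k\<close>, whose norms are known
  exactly; Fatou's lemma passes to the limit \<open>k \<rightarrow> \<infinity>\<close>.
\<close>

lemma hermite_expansion_remainder:
  assumes "hermite_expansion m f C"
  shows "(\<integral>\<^sup>+q. ennreal ((norm (f q - (\<Sum>n<N. quat_hermite n m q * C n)))\<^sup>2) \<partial>gauss_measure)
    \<le> ennreal ((\<Sum>n. hermite_weight m n * (norm (C n))\<^sup>2) - (\<Sum>n<N. hermite_weight m n * (norm (C n))\<^sup>2))"
proof -
  let ?a = "\<lambda>n. hermite_weight m n * (norm (C n))\<^sup>2"
  let ?H = "\<lambda>q n. quat_hermite n m q * C n"
  have split: "{..<N + k} = {..<N} \<union> {N..<N + k}" "{..<N} \<inter> {N..<N + k} = {}" for k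
    by auto
  have partial: "(\<Sum>n\<in>{N..<N + k}. g n) = (\<Sum>n<N + k. g n) - (\<Sum>n<N. g n)"
    for k and g :: "nat \<Rightarrow> 'c::ab_group_add"
    unfolding split(1) using split(2) by (simp add: sum.union_disjoint)
  show ?thesis
  proof (rule nn_integral_norm_sq_limit_le)
    fix k
    show "(\<lambda>q. \<Sum>n\<in>{N..<N + k}. ?H q n) \<in> borel_measurable gauss_measure"
      unfolding measurable_gauss_measure by measurable
    have "(\<Sum>n<N + k. ?a n) \<le> (\<Sum>n. ?a n)"
      using assms hermite_weight_pos
      by (intro sum_le_suminf) (simp_all add: hermite_expansion_def less_imp_le)
    then show "(\<integral>\<^sup>+q. ennreal ((norm (\<Sum>n\<in>{N..<N + k}. ?H q n))\<^sup>2) \<partial>gauss_measure)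
        \<le> ennreal ((\<Sum>n. ?a n) - (\<Sum>n<N. ?a n))"
      by (simp only: nn_integral_hermite_sum_norm_sq[OF finite_atLeastLessThan])
        (simp add: partial ennreal_leI)
  next
    fix q
    have "(\<lambda>k. \<Sum>n<k. ?H q n) \<longlonglongrightarrow> f q"
      using assms by (simp add: hermite_expansion_def sums_def)
    then have "(\<lambda>k. \<Sum>n<N + k. ?H q n) \<longlonglongrightarrow> f q"
      using LIMSEQ_ignore_initial_segment[of _ _ N] by (simp add: add.commute)
    then show "(\<lambda>k. \<Sum>n\<in>{N..<N + k}. ?H q n) \<longlonglongrightarrow> f q - (\<Sum>n<N. ?H q n)"
      unfolding partial by (intro tendsto_intros)
  qed
qed

text \<open>
  Write \<open>f\<^sub>N\<close> and \<open>g\<^sub>N\<close> for the partial sums. The partial sums of the claimed series are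
  \<open>\<langle>f\<^sub>N, g\<^sub>N\<rangle>\<close>, and \<open>\<langle>f, g\<rangle> - \<langle>f\<^sub>N, g\<^sub>N\<rangle> = \<langle>f - f\<^sub>N, g\<rangle> + \<langle>f\<^sub>N, g - g\<^sub>N\<rangle>\<close> is bounded by the Cauchy-Schwarz
  inequality in terms of the tails of the two coefficient series.
\<close>

lemma parseval:
  assumes f: "hermite_expansion m f C" and g: "hermite_expansion m g D"
  shows gauss_integrable_qcnj_mult: "gauss_integrable (\<lambda>q. qcnj (f q) * g q)"
    and bargmann_inner_sums: "(\<lambda>n. hermite_weight m n *\<^sub>R (qcnj (C n) * D n)) sums bargmann_inner f g"
proof -
  note [measurable] = hermite_expansion_measurable[OF f] hermite_expansion_measurable[OF g]
  define a where "a = (\<lambda>n. hermite_weight m n * (norm (C n))\<^sup>2)"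
  define b where "b = (\<lambda>n. hermite_weight m n * (norm (D n))\<^sup>2)"
  define fN where "fN = (\<lambda>N q. \<Sum>n<N. quat_hermite n m q * C n)"
  define gN where "gN = (\<lambda>N q. \<Sum>n<N. quat_hermite n m q * D n)"
  have [measurable]: "fN N \<in> borel_measurable borel" "gN N \<in> borel_measurable borel" for N
    unfolding fN_def gN_def by measurable
  note gm = measurable_gauss_measure
  have nonneg: "0 \<le> a n" "0 \<le> b n" for n
    using hermite_weight_pos[of m n] by (simp_all add: a_def b_def)
  have summable: "summable a" "summable b"
    using f g by (simp_all add: hermite_expansion_def a_def b_def)
  have le: "sum a {..<N} \<le> suminf a" "sum b {..<N} \<le> suminf b" for N
    using summable nonneg by (auto intro!: sum_le_suminf)
  have A0: "0 \<le> suminf a" "0 \<le> suminf b"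
    using le[of 0] by simp_all
  have rf: "(\<integral>\<^sup>+q. ennreal ((norm (f q - fN N q))\<^sup>2) \<partial>gauss_measure) \<le> ennreal (suminf a - sum a {..<N})"
    and rg: "(\<integral>\<^sup>+q. ennreal ((norm (g q - gN N q))\<^sup>2) \<partial>gauss_measure) \<le> ennreal (suminf b - sum b {..<N})" for N
    unfolding fN_def gN_def a_def b_def by (rule hermite_expansion_remainder f g)+
  \<comment> \<open>for \<open>N = 0\<close> the remainder is the whole function\<close>
  have nf: "(\<integral>\<^sup>+q. ennreal ((norm (f q))\<^sup>2) \<partial>gauss_measure) \<le> ennreal (suminf a)"
    and ng: "(\<integral>\<^sup>+q. ennreal ((norm (g q))\<^sup>2) \<partial>gauss_measure) \<le> ennreal (suminf b)"
    using rf[of 0] rg[of 0] by (simp_all add: fN_def gN_def)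
  have nfN: "(\<integral>\<^sup>+q. ennreal ((norm (fN N q))\<^sup>2) \<partial>gauss_measure) \<le> ennreal (suminf a)" for N
    using le(1)[of N] by (simp add: fN_def nn_integral_hermite_sum_norm_sq a_def ennreal_leI)
  have int: "integrable gauss_measure (\<lambda>q. qcnj (f q) * g q)"
    by (rule L2_integrable_qcnj_mult[OF _ _ nf ng A0]) (simp_all add: gm)
  have meas: "(\<lambda>q. qcnj (f q) * g q) \<in> borel_measurable borel"
    using borel_measurable_integrable[OF int] by (simp add: gm)
  show "gauss_integrable (\<lambda>q. qcnj (f q) * g q)"
    using int by (simp add: gauss_integrable_iff[OF meas])
  have ip: "bargmann_inner f g = (\<integral>q. qcnj (f q) * g q \<partial>gauss_measure)"
    unfolding bargmann_inner_def by (rule gauss_integral_eq[OF int])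
  have bound: "norm ((\<Sum>n<N. hermite_weight m n *\<^sub>R (qcnj (C n) * D n)) - bargmann_inner f g)
      \<le> sqrt ((suminf a - sum a {..<N}) * suminf b) + sqrt (suminf a * (suminf b - sum b {..<N}))" for N
  proof -
    have t: "0 \<le> suminf a - sum a {..<N}" "0 \<le> suminf b - sum b {..<N}"
      using le by simp_all
    have m1: "(\<lambda>q. f q - fN N q) \<in> borel_measurable gauss_measure"
      "(\<lambda>q. g q - gN N q) \<in> borel_measurable gauss_measure"
      "fN N \<in> borel_measurable gauss_measure" "g \<in> borel_measurable gauss_measure"
      unfolding gm by measurable
    note i1 = L2_qcnj_mult[OF m1(1,4) rf[of N] ng t(1) A0(2)]
    note i2 = L2_qcnj_mult[OF m1(3,2) nfN[of N] rg[of N] A0(1) t(2)]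
    have iN: "integrable gauss_measure (\<lambda>q. qcnj (fN N q) * gN N q)"
      "(\<integral>q. qcnj (fN N q) * gN N q \<partial>gauss_measure) = (\<Sum>n<N. hermite_weight m n *\<^sub>R (qcnj (C n) * D n))"
      unfolding fN_def gN_def by (rule integral_hermite_sum_inner; simp)+
    have "bargmann_inner f g - (\<Sum>n<N. hermite_weight m n *\<^sub>R (qcnj (C n) * D n))
        = (\<integral>q. qcnj (f q) * g q - qcnj (fN N q) * gN N q \<partial>gauss_measure)"
      using int iN by (simp add: ip)
    also have "\<dots> = (\<integral>q. qcnj (f q - fN N q) * g q + qcnj (fN N q) * (g q - gN N q) \<partial>gauss_measure)"
      by (simp add: algebra_simps)
    also have "\<dots> = (\<integral>q. qcnj (f q - fN N q) * g q \<partial>gauss_measure)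
        + (\<integral>q. qcnj (fN N q) * (g q - gN N q) \<partial>gauss_measure)"
      by (rule Bochner_Integration.integral_add[OF i1(1) i2(1)])
    finally show ?thesis
      using norm_triangle_mono[OF i1(2) i2(2)] by (simp add: norm_minus_commute)
  qed
  have "(\<lambda>N. sqrt ((suminf a - sum a {..<N}) * suminf b) + sqrt (suminf a * (suminf b - sum b {..<N})))
      \<longlonglongrightarrow> sqrt ((suminf a - suminf a) * suminf b) + sqrt (suminf a * (suminf b - suminf b))"
    by (intro tendsto_intros summable_LIMSEQ summable)
  then have lim: "(\<lambda>N. sqrt ((suminf a - sum a {..<N}) * suminf b) + sqrt (suminf a * (suminf b - sum b {..<N})))
      \<longlonglongrightarrow> 0" by simp
  show "(\<lambda>n. hermite_weight m n *\<^sub>R (qcnj (C n) * D n)) sums bargmann_inner f g"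
    unfolding sums_def
    by (rule LIM_zero_cancel, rule Lim_null_comparison[OF _ lim]) (simp add: bound)
qed

section \<open>Completeness of weighted square-summable sequences\<close>

lemma weighted_l2_summable_add:
  fixes C D :: "nat \<Rightarrow> 'a::real_normed_vector"
  assumes "\<And>n. 0 \<le> w n" "summable (\<lambda>n. w n * (norm (C n))\<^sup>2)" "summable (\<lambda>n. w n * (norm (D n))\<^sup>2)"
  shows "summable (\<lambda>n. w n * (norm (C n + D n))\<^sup>2)"
proof (rule summable_comparison_test')
  show "summable (\<lambda>n. 2 * (w n * (norm (C n))\<^sup>2) + 2 * (w n * (norm (D n))\<^sup>2))"
    using assms by (intro summable_add summable_mult)
  fix n
  have "(norm (C n + D n))\<^sup>2 \<le> 2 * (norm (C n))\<^sup>2 + 2 * (norm (D n))\<^sup>2"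
    using power_mono[OF norm_triangle_ineq[of "C n" "D n"], of 2] sum_squares_bound[of "norm (C n)" "norm (D n)"]
    by (simp add: power2_sum)
  then have "w n * (norm (C n + D n))\<^sup>2 \<le> w n * (2 * (norm (C n))\<^sup>2 + 2 * (norm (D n))\<^sup>2)"
    by (intro mult_left_mono assms)
  then show "norm (w n * (norm (C n + D n))\<^sup>2) \<le> 2 * (w n * (norm (C n))\<^sup>2) + 2 * (w n * (norm (D n))\<^sup>2)"
    using assms(1)[of n] by (simp add: distrib_left mult.left_commute)
qed

text \<open>
  The usual argument for \<open>\<ell>\<^sup>2\<close>: coordinates converge because the weights are positive, and the Cauchy
  condition survives the limit on every finite section.
\<close>

lemma weighted_l2_complete:
  fixes C :: "nat \<Rightarrow> nat \<Rightarrow> 'a::banach"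
  assumes w: "\<And>n. 0 < w n"
    and C: "\<And>i. summable (\<lambda>n. w n * (norm (C i n))\<^sup>2)"
    and cauchy: "\<And>e. 0 < e \<Longrightarrow> \<exists>N. \<forall>i\<ge>N. \<forall>j\<ge>N. (\<Sum>n. w n * (norm (C i n - C j n))\<^sup>2) < e"
  obtains D where "summable (\<lambda>n. w n * (norm (D n))\<^sup>2)"
    and "(\<lambda>i. \<Sum>n. w n * (norm (C i n - D n))\<^sup>2) \<longlonglongrightarrow> 0"
proof -
  have w0: "0 \<le> w n" for n using w[of n] by simp
  have diff: "summable (\<lambda>n. w n * (norm (C i n - C j n))\<^sup>2)" for i j
    using weighted_l2_summable_add[where C = "C i" and D = "\<lambda>n. - C j n" and w = w] C w0 by simp
  have partial: "(\<Sum>n<K. w n * (norm (C i n - C j n))\<^sup>2) \<le> (\<Sum>n. w n * (norm (C i n - C j n))\<^sup>2)" for i j K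
    using w0 by (intro sum_le_suminf diff) auto
  have "Cauchy (\<lambda>i. C i k)" for k
  proof (rule metric_CauchyI)
    fix e :: real assume "0 < e"
    then obtain N where N: "\<And>i j. i \<ge> N \<Longrightarrow> j \<ge> N \<Longrightarrow> (\<Sum>n. w n * (norm (C i n - C j n))\<^sup>2) < w k * e\<^sup>2"
      using cauchy[of "w k * e\<^sup>2"] w[of k] by auto
    have "dist (C i k) (C j k) < e" if "i \<ge> N" "j \<ge> N" for i j
    proof -
      have "w k * (norm (C i k - C j k))\<^sup>2 \<le> (\<Sum>n<Suc k. w n * (norm (C i n - C j n))\<^sup>2)"
        using w0 by (intro member_le_sum) auto
      also have "\<dots> < w k * e\<^sup>2"
        using partial[of i j "Suc k"] N[OF that] by simp
      finally have "(norm (C i k - C j k))\<^sup>2 < e\<^sup>2"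
        using w[of k] by simp
      then show ?thesis
        using \<open>0 < e\<close> by (simp add: dist_norm power_less_imp_less_base)
    qed
    then show "\<exists>N. \<forall>i\<ge>N. \<forall>j\<ge>N. dist (C i k) (C j k) < e" by blast
  qed
  then have "\<forall>k. \<exists>d. (\<lambda>i. C i k) \<longlonglongrightarrow> d"
    by (simp add: Cauchy_convergent_iff convergent_def)
  then obtain D where D: "\<And>k. (\<lambda>i. C i k) \<longlonglongrightarrow> D k"
    by metis
  have key: "\<exists>N. \<forall>i\<ge>N. summable (\<lambda>n. w n * (norm (C i n - D n))\<^sup>2) \<and> (\<Sum>n. w n * (norm (C i n - D n))\<^sup>2) \<le> e"
    if e: "0 < e" for e
  proof -
    obtain N where N: "\<And>i j. i \<ge> N \<Longrightarrow> j \<ge> N \<Longrightarrow> (\<Sum>n. w n * (norm (C i n - C j n))\<^sup>2) < e"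
      using cauchy[OF e] by blast
    have "summable (\<lambda>n. w n * (norm (C i n - D n))\<^sup>2) \<and> (\<Sum>n. w n * (norm (C i n - D n))\<^sup>2) \<le> e"
      if i: "i \<ge> N" for i
    proof -
      have bound: "(\<Sum>n<K. w n * (norm (C i n - D n))\<^sup>2) \<le> e" for K
      proof (rule LIMSEQ_le_const2)
        show "(\<lambda>j. \<Sum>n<K. w n * (norm (C i n - C j n))\<^sup>2) \<longlonglongrightarrow> (\<Sum>n<K. w n * (norm (C i n - D n))\<^sup>2)"
          by (intro tendsto_intros D)
        show "\<exists>M. \<forall>j\<ge>M. (\<Sum>n<K. w n * (norm (C i n - C j n))\<^sup>2) \<le> e"
        proof (intro exI allI impI)
          fix j assume "N \<le> j"
          from N[OF i this] partial[of i j K]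
          show "(\<Sum>n<K. w n * (norm (C i n - C j n))\<^sup>2) \<le> e" by linarith
        qed
      qed
      have s: "summable (\<lambda>n. w n * (norm (C i n - D n))\<^sup>2)"
      proof (rule bounded_imp_summable)
        show "0 \<le> w n * (norm (C i n - D n))\<^sup>2" for n
          using w0 by simp
        show "(\<Sum>n\<le>K. w n * (norm (C i n - D n))\<^sup>2) \<le> e" for K
          using bound[of "Suc K"] by (simp only: lessThan_Suc_atMost)
      qed
      show ?thesis
        by (rule conjI[OF s suminf_le_const[OF s bound]])
    qed
    then show ?thesis by blast
  qed
  obtain i where i: "summable (\<lambda>n. w n * (norm (C i n - D n))\<^sup>2)"
    using key[OF zero_less_one] by (metis order_refl)
  have "summable (\<lambda>n. w n * (norm (C i n + (D n - C i n)))\<^sup>2)"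
    by (rule weighted_l2_summable_add) (use w0 C i in \<open>simp_all only: norm_minus_commute[of "D _"]\<close>)
  then have "summable (\<lambda>n. w n * (norm (D n))\<^sup>2)"
    by simp
  moreover have "(\<lambda>i. \<Sum>n. w n * (norm (C i n - D n))\<^sup>2) \<longlonglongrightarrow> 0"
  proof (rule LIMSEQ_I)
    fix e :: real assume "0 < e"
    then have "0 < e / 2" by simp
    from key[OF this] obtain N where N: "\<forall>i\<ge>N. summable (\<lambda>n. w n * (norm (C i n - D n))\<^sup>2)
        \<and> (\<Sum>n. w n * (norm (C i n - D n))\<^sup>2) \<le> e / 2"
      ..
    have "norm ((\<Sum>n. w n * (norm (C i n - D n))\<^sup>2) - 0) < e" if "i \<ge> N" for i
    proof -
      have "0 \<le> (\<Sum>n. w n * (norm (C i n - D n))\<^sup>2)"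
        using w0 by (intro suminf_nonneg N[rule_format, OF that, THEN conjunct1]) simp
      then show ?thesis
        using N[rule_format, OF that] \<open>0 < e\<close> by simp
    qed
    then show "\<exists>N. \<forall>i\<ge>N. norm ((\<Sum>n. w n * (norm (C i n - D n))\<^sup>2) - 0) < e" by blast
  qed
  ultimately show thesis
    by (rule that[of D])
qed

section \<open>Operations on Hermite expansions\<close>

lemma hermite_expansion_zero: "hermite_expansion m 0 (\<lambda>n. 0)"
  by (simp add: hermite_expansion_def)

lemma hermite_expansion_add:
  assumes "hermite_expansion m f C" "hermite_expansion m g D"
  shows "hermite_expansion m (f + g) (\<lambda>n. C n + D n)"
  using assms weighted_l2_summable_add[of "hermite_weight m" C D] hermite_weight_pos[of m]
  by (auto simp: hermite_expansion_def distrib_left less_imp_le intro: sums_add)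

lemma hermite_expansion_right_mult:
  assumes "hermite_expansion m f C"
  shows "hermite_expansion m (right_mult f a) (\<lambda>n. C n * a)"
proof -
  have "summable (\<lambda>n. (hermite_weight m n * (norm (C n))\<^sup>2) * (norm a)\<^sup>2)"
    using assms by (intro summable_mult2) (simp add: hermite_expansion_def)
  moreover have "(\<lambda>n. (quat_hermite n m q * C n) * a) sums (f q * a)" for q
    using assms by (intro sums_mult2) (simp add: hermite_expansion_def)
  ultimately show ?thesis
    by (simp add: hermite_expansion_def right_mult_def norm_mult power_mult_distrib mult.assoc)
qed

lemma hermite_expansion_diff:
  assumes "hermite_expansion m f C" "hermite_expansion m g D"
  shows "hermite_expansion m (f - g) (\<lambda>n. C n - D n)"
proof -
  have "f - g = f + right_mult g (- 1)"
    by (simp add: fun_eq_iff right_mult_def)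
  moreover have "(\<lambda>n. C n + D n * - 1) = (\<lambda>n. C n - D n)"
    by (simp add: fun_eq_iff)
  ultimately show ?thesis
    using hermite_expansion_add[OF assms(1) hermite_expansion_right_mult[OF assms(2), of "- 1"]] by metis
qed

lemma hermite_expansion_finite:
  assumes "finite A"
  shows "hermite_expansion m (\<Sum>n\<in>A. right_mult (quat_hermite n m) (C n)) (\<lambda>n. if n \<in> A then C n else 0)"
proof -
  have "(\<Sum>n\<in>A. right_mult (quat_hermite n m) (C n)) q = (\<Sum>n\<in>A. quat_hermite n m q * C n)" for q
    using assms by (induction A) (simp_all add: right_mult_def)
  moreover have "(\<lambda>n. quat_hermite n m q * (if n \<in> A then C n else 0)) sums (\<Sum>n\<in>A. quat_hermite n m q * C n)" for q
    using sums_If_finite_set[OF assms, of "\<lambda>n. quat_hermite n m q * C n"]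
    by (simp add: if_distrib cong: if_cong)
  moreover have "summable (\<lambda>n. hermite_weight m n * (norm (if n \<in> A then C n else 0))\<^sup>2)"
    by (rule summable_finite[OF assms]) simp
  ultimately show ?thesis
    by (simp add: hermite_expansion_def)
qed

lemma hermite_expansion_quat_hermite:
  "hermite_expansion m (quat_hermite k m) (\<lambda>n. if n = k then 1 else 0)"
proof -
  have "right_mult (quat_hermite k m) 1 = quat_hermite k m"
    by (simp add: right_mult_def)
  then show ?thesis
    using hermite_expansion_finite[of "{k}" m "\<lambda>_. 1"] by simp
qed

text \<open>
  The converse direction of the identification with a sequence space: it is what makes the limit found
  among coefficient sequences come from a function.
\<close>

lemma hermite_expansion_exists:
  assumes "summable (\<lambda>n. hermite_weight m n * (norm (C n))\<^sup>2)"
  obtains f where "hermite_expansion m f C"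
proof
  have "summable (\<lambda>n. inverse (pi * fact m) * (hermite_weight m n * (norm (C n))\<^sup>2))"
    using assms by (rule summable_mult)
  also have "(\<lambda>n. inverse (pi * fact m) * (hermite_weight m n * (norm (C n))\<^sup>2))
      = (\<lambda>n. fact n * (norm (C n))\<^sup>2)"
  proof
    fix n
    have "inverse (pi * fact m) * (pi * fact m) = (1 :: real)"
      by (rule left_inverse) simp
    then show "inverse (pi * fact m) * (hermite_weight m n * (norm (C n))\<^sup>2) = fact n * (norm (C n))\<^sup>2"
      unfolding hermite_weight_def by (metis mult.assoc mult_1_left)
  qed
  finally have "summable (\<lambda>n. fact n * (norm (C n))\<^sup>2)" .
  then show "hermite_expansion m (\<lambda>q. \<Sum>n. quat_hermite n m q * C n) C"
    using assms by (simp add: hermite_expansion_def summable_sums summable_quat_hermite_series)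
qed

section \<open>The Hilbert space and its basis\<close>

lemma bargmann_norm_sums:
  assumes "hermite_expansion m f C"
  shows "(\<lambda>n. hermite_weight m n * (norm (C n))\<^sup>2) sums qRe (bargmann_inner f f)"
proof -
  have "bounded_linear qRe"
    by (rule bounded_linear_intro[where K = 1]) (simp_all add: norm_quat_def real_le_rsqrt)
  from bounded_linear.sums[OF this bargmann_inner_sums[OF assms assms]] show ?thesis
    by (simp add: qcnj_mult_self)
qed

lemma ip_norm_bargmann:
  assumes "hermite_expansion m f C"
  shows "ip_norm bargmann_inner f = sqrt (\<Sum>n. hermite_weight m n * (norm (C n))\<^sup>2)"
  using bargmann_norm_sums[OF assms] by (simp add: ip_norm_def sums_iff)

text \<open>
  Every axiom is read off from Parseval's identity. For definiteness, a vanishing sum of nonnegative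
  terms with positive weights has vanishing coefficients, hence a vanishing function.
\<close>

lemma bargmann_inner_product_space:
  "right_quat_inner_product_space (gen_bargmann m) right_mult bargmann_inner"
proof
  show "0 \<in> gen_bargmann m"
    using hermite_expansion_zero by (auto simp: gen_bargmann_iff)
next
  fix f g assume "f \<in> gen_bargmann m" "g \<in> gen_bargmann m"
  then show "f + g \<in> gen_bargmann m"
    unfolding gen_bargmann_iff using hermite_expansion_add by blast
next
  fix f a assume "f \<in> gen_bargmann m"
  then show "right_mult f a \<in> gen_bargmann m"
    unfolding gen_bargmann_iff using hermite_expansion_right_mult by blast
next
  fix f g assume "f \<in> gen_bargmann m" "g \<in> gen_bargmann m"
  then obtain C D where f: "hermite_expansion m f C" and g: "hermite_expansion m g D"
    by (auto simp: gen_bargmann_iff)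
  have "(\<lambda>n. qcnj (hermite_weight m n *\<^sub>R (qcnj (D n) * C n))) sums qcnj (bargmann_inner g f)"
    by (rule bounded_linear.sums[OF bounded_linear_qcnj bargmann_inner_sums[OF g f]])
  then show "bargmann_inner f g = qcnj (bargmann_inner g f)"
    using bargmann_inner_sums[OF f g] by (simp add: sums_unique2)
next
  fix f g h assume "f \<in> gen_bargmann m" "g \<in> gen_bargmann m" "h \<in> gen_bargmann m"
  then obtain B C D where f: "hermite_expansion m f B" and g: "hermite_expansion m g C"
    and h: "hermite_expansion m h D"
    by (auto simp: gen_bargmann_iff)
  show "bargmann_inner f (g + h) = bargmann_inner f g + bargmann_inner f h"
    using bargmann_inner_sums[OF f hermite_expansion_add[OF g h]]
      sums_add[OF bargmann_inner_sums[OF f g] bargmann_inner_sums[OF f h]]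
    by (simp add: distrib_left scaleR_add_right sums_unique2)
next
  fix f g a assume "f \<in> gen_bargmann m" "g \<in> gen_bargmann m"
  then obtain C D where f: "hermite_expansion m f C" and g: "hermite_expansion m g D"
    by (auto simp: gen_bargmann_iff)
  show "bargmann_inner f (right_mult g a) = bargmann_inner f g * a"
    using bargmann_inner_sums[OF f hermite_expansion_right_mult[OF g, of a]]
      sums_mult2[OF bargmann_inner_sums[OF f g], of a]
    by (simp add: mult.assoc sums_unique2)
next
  fix f assume "f \<in> gen_bargmann m"
  then obtain C where f: "hermite_expansion m f C"
    by (auto simp: gen_bargmann_iff)
  have nonneg: "0 \<le> hermite_weight m n * (norm (C n))\<^sup>2" for n
    using hermite_weight_pos[of m n] by simp
  show "0 \<le> qRe (bargmann_inner f f)"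
    by (rule sums_le[OF nonneg sums_zero bargmann_norm_sums[OF f]])
  assume "bargmann_inner f f = 0"
  then have "(\<lambda>n. hermite_weight m n * (norm (C n))\<^sup>2) sums 0"
    using bargmann_norm_sums[OF f] by simp
  then have "C n = 0" for n
    using suminf_eq_zero_iff[of "\<lambda>n. hermite_weight m n * (norm (C n))\<^sup>2"] nonneg
      less_imp_neq[OF hermite_weight_pos[of m n]]
    by (auto simp: sums_iff)
  then have "f q = 0" for q
    using f sums_unique2[OF sums_zero] by (auto simp: hermite_expansion_def)
  then show "f = 0" by (simp add: fun_eq_iff)
qed (simp_all add: right_mult_def fun_eq_iff algebra_simps)

lemma bargmann_hilbert_space:
  "right_quat_hilbert_space (gen_bargmann m) right_mult bargmann_inner"
proof -
  interpret right_quat_inner_product_space "gen_bargmann m" right_mult bargmann_inner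
    by (rule bargmann_inner_product_space)
  show ?thesis
  proof
    fix X :: "nat \<Rightarrow> quat \<Rightarrow> quat"
    assume X: "\<And>n. X n \<in> gen_bargmann m"
      and cauchy: "\<forall>e>0. \<exists>N. \<forall>i\<ge>N. \<forall>j\<ge>N. ip_norm bargmann_inner (X i - X j) < e"
    from X have "\<forall>i. \<exists>C. hermite_expansion m (X i) C"
      by (simp add: gen_bargmann_iff)
    then obtain C where C: "\<And>i. hermite_expansion m (X i) (C i)"
      by metis
    obtain D where D: "summable (\<lambda>n. hermite_weight m n * (norm (D n))\<^sup>2)"
      and lim: "(\<lambda>i. \<Sum>n. hermite_weight m n * (norm (C i n - D n))\<^sup>2) \<longlonglongrightarrow> 0"
    proof (rule weighted_l2_complete[of "hermite_weight m" C])
      show "summable (\<lambda>n. hermite_weight m n * (norm (C i n))\<^sup>2)" for i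
        using C by (simp add: hermite_expansion_def)
      show "\<exists>N. \<forall>i\<ge>N. \<forall>j\<ge>N. (\<Sum>n. hermite_weight m n * (norm (C i n - C j n))\<^sup>2) < e"
        if "0 < e" for e
        using cauchy[rule_format, of "sqrt e"] that
        by (simp add: ip_norm_bargmann[OF hermite_expansion_diff[OF C C]])
    qed (simp_all add: hermite_weight_pos)
    from D obtain f where f: "hermite_expansion m f D"
      by (rule hermite_expansion_exists)
    have "(\<lambda>i. ip_norm bargmann_inner (X i - f)) \<longlonglongrightarrow> 0"
      using tendsto_real_sqrt[OF lim] by (simp add: ip_norm_bargmann[OF hermite_expansion_diff[OF C f]])
    moreover have "f \<in> gen_bargmann m"
      using f by (auto simp: gen_bargmann_iff)
    ultimately show "\<exists>f\<in>gen_bargmann m. (\<lambda>n. ip_norm bargmann_inner (X n - f)) \<longlonglongrightarrow> 0"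
      by blast
  qed
qed

lemma bargmann_inner_quat_hermite:
  "bargmann_inner (quat_hermite n m) (quat_hermite k m) = (if n = k then hermite_weight m n *\<^sub>R 1 else 0)"
proof -
  have "bargmann_inner (quat_hermite n m) (quat_hermite k m)
      = (\<integral>q. qcnj (quat_hermite n m q) * quat_hermite k m q \<partial>gauss_measure)"
    unfolding bargmann_inner_def by (rule gauss_integral_eq[OF integrable_hermite_inner])
  then show ?thesis
    by (simp add: integral_hermite_inner hermite_weight_def)
qed

text \<open>
  The partial sums of the expansion of \<open>f\<close> converge to \<open>f\<close> in norm: by Parseval's identity the error is a
  tail of a convergent series.
\<close>

lemma hermite_span_dense:
  assumes f: "hermite_expansion m f C"
  shows "(\<lambda>N. ip_norm bargmann_inner (f - (\<Sum>n<N. right_mult (quat_hermite n m) (C n)))) \<longlonglongrightarrow> 0"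
proof -
  let ?a = "\<lambda>n. hermite_weight m n * (norm (C n))\<^sup>2"
  have a: "summable ?a" using f by (simp add: hermite_expansion_def)
  have "ip_norm bargmann_inner (f - (\<Sum>n<N. right_mult (quat_hermite n m) (C n)))
      = sqrt (suminf ?a - sum ?a {..<N})" for N
  proof -
    have "(\<lambda>n. ?a n - (if n \<in> {..<N} then ?a n else 0)) sums (suminf ?a - sum ?a {..<N})"
      by (intro sums_diff summable_sums a sums_If_finite_set) simp
    also have "(\<lambda>n. ?a n - (if n \<in> {..<N} then ?a n else 0))
        = (\<lambda>n. hermite_weight m n * (norm (C n - (if n \<in> {..<N} then C n else 0)))\<^sup>2)"
      by auto
    finally show ?thesis
      by (simp add: ip_norm_bargmann[OF hermite_expansion_diff[OF f hermite_expansion_finite[OF finite_lessThan]]] sums_iff)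
  qed
  moreover have "(\<lambda>N. sqrt (suminf ?a - sum ?a {..<N})) \<longlonglongrightarrow> sqrt (suminf ?a - suminf ?a)"
    by (intro tendsto_intros summable_LIMSEQ a)
  ultimately show ?thesis by simp
qed

lemma orthogonal_basis_quat_hermite:
  "orthogonal_basis (gen_bargmann m) right_mult bargmann_inner (\<lambda>n. quat_hermite n m)"
  unfolding orthogonal_basis_def
proof (intro conjI allI impI ballI)
  fix n
  show "quat_hermite n m \<in> gen_bargmann m"
    using hermite_expansion_quat_hermite by (auto simp: gen_bargmann_iff)
  show "quat_hermite n m \<noteq> 0"
  proof
    assume "quat_hermite n m = 0"
    then have "bargmann_inner (quat_hermite n m) (quat_hermite n m) = 0"
      by (simp add: bargmann_inner_def gauss_integral_def)
    then show False
      using hermite_weight_pos[of m n] by (simp add: bargmann_inner_quat_hermite)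
  qed
next
  fix i j :: nat assume "i \<noteq> j"
  then show "bargmann_inner (quat_hermite i m) (quat_hermite j m) = 0"
    by (simp add: bargmann_inner_quat_hermite)
next
  fix f and e :: real assume "f \<in> gen_bargmann m" "0 < e"
  then obtain C where "hermite_expansion m f C"
    by (auto simp: gen_bargmann_iff)
  from order_tendstoD(2)[OF hermite_span_dense[OF this] \<open>0 < e\<close>]
  obtain N where "ip_norm bargmann_inner (f - (\<Sum>n<N. right_mult (quat_hermite n m) (C n))) < e"
    by (auto simp: eventually_sequentially)
  then show "\<exists>A c. finite A \<and> ip_norm bargmann_inner (f - (\<Sum>n\<in>A. right_mult (quat_hermite n m) (c n))) < e"
    by blast
qed

theorem theorem5p2:
  fixes m :: nat
  shows "(\<forall>f \<in> gen_bargmann m. \<forall>g \<in> gen_bargmann m. gauss_integrable (\<lambda>q. qcnj (f q) * g q)) \<and>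
    right_quat_hilbert_space (gen_bargmann m) right_mult bargmann_inner \<and>
    (\<forall>n. quat_hermite n m \<in> gen_bargmann m) \<and>
    orthogonal_basis (gen_bargmann m) right_mult bargmann_inner (\<lambda>n. quat_hermite n m)"
  using gauss_integrable_qcnj_mult bargmann_hilbert_space orthogonal_basis_quat_hermite[of m]
  by (auto simp: gen_bargmann_iff orthogonal_basis_def)

end
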